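(* Let $p$ and $q$ be monic polynomials with degree $2$ of $\mathbb{F}[t]$. Assume that $p$ is irreducible over $\mathbb{F}$ and that $q$ splits over $\mathbb{F}$. Assume furthermore that $q$ has a double root, or that $\mathbb{F}$ has characteristic $2$ and $\operatorname{tr}(q)=\operatorname{tr}(p)$. Choose a root $y$ of $q$ in $\mathbb{F}$. Then, given an endomorphism $u$ of a finite-dimensional vector space $V$ over $\mathbb{F}$, the following conditions are equivalent: (i) $u$ is a d-exceptional $(p,q)$-difference. (ii) The minimal polynomial of $u$ is a power of $p(t+y)$. (iii) In some basis of $V$, the endomorphism $u$ is represented by a block-diagonal matrix in which every diagonal block equals $C\bigl(p(t+y)^n\bigr)$ for some positive integer $n$.
   Context: $\mathbb{F}$ is an arbitrary field with algebraic closure $\overline{\mathbb{F}}$. For a monic polynomial $p$ of degree $n\ge 1$, $\operatorname{tr}(p)$ is the opposite of the coefficient of $p$ on $t^{n-1}$, and $\operatorname{Root}(p)$ is its set of roots in $\overline{\mathbb{F}}$. An endomorphism $u$ of $V$ is a $(p,q)$-difference if $u=a-b$ for some endomorphisms $a,b$ of $V$ with $p(a)=0$ and $q(b)=0$. It is d-exceptional with respect to $(p,q)$ if all its eigenvalues in $\overline{\mathbb{F}}$ belong to $\operatorname{Root}(p)-\operatorname{Root}(q)=\{x-y: x\in\operatorname{Root}(p),\,y\in\operatorname{Root}(q)\}$; a d-exceptional $(p,q)$-difference is a $(p,q)$-difference that is d-exceptional with respect to $(p,q)$. $C(r)$ is the companion matrix of the monic polynomial $r$. *)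

theory Defs
  imports
    "HOL-Algebra.Algebraic_Closure_Type"
    "Jordan_Normal_Form.Char_Poly"
begin

section \<open>Polynomials over a field\<close>

text \<open>Only meant for monic polynomials of degree at least 1.\<close>
definition poly_tr :: "'a::field poly \<Rightarrow> 'a" where
  "poly_tr p = - coeff p (degree p - 1)"

definition splits :: "'a::field poly \<Rightarrow> bool" where
  "splits p \<longleftrightarrow> (\<exists>xs. p = smult (lead_coeff p) (\<Prod>x\<leftarrow>xs. [:- x, 1:]))"

definition Root :: "'a::field poly \<Rightarrow> 'a alg_closure set" where
  "Root p = {x. poly (map_poly to_ac p) x = 0}"

text \<open>Convention for the companion matrix of a monic polynomial of degree \<open>n\<close>: ones on the
  subdiagonal, and the negated coefficients of \<open>1, t, \<dots>, t^(n-1)\<close> down the last column.\<close>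
definition companion_mat :: "'a::field poly \<Rightarrow> 'a mat" where
  "companion_mat r = mat (degree r) (degree r)
     (\<lambda>(i, j). if j = degree r - 1 then - coeff r i
               else if i = Suc j then 1 else 0)"

section \<open>Endomorphisms of a vector space\<close>

text \<open>The vector space is the whole type \<open>'v\<close> with scalar multiplication \<open>scale\<close>.\<close>

definition poly_endo ::
  "('a::field \<Rightarrow> 'v::ab_group_add \<Rightarrow> 'v) \<Rightarrow> 'a poly \<Rightarrow> ('v \<Rightarrow> 'v) \<Rightarrow> 'v \<Rightarrow> 'v" where
  "poly_endo scale f u v = (\<Sum>i\<le>degree f. scale (coeff f i) ((u ^^ i) v))"

definition annihilates ::
  "('a::field \<Rightarrow> 'v::ab_group_add \<Rightarrow> 'v) \<Rightarrow> 'a poly \<Rightarrow> ('v \<Rightarrow> 'v) \<Rightarrow> bool" where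
  "annihilates scale f u \<longleftrightarrow> (\<forall>v. poly_endo scale f u v = 0)"

text \<open>The monic generator of the ideal of annihilating polynomials; it is \<open>1\<close> on the zero
  space.\<close>
definition is_minimal_poly ::
  "('a::field \<Rightarrow> 'v::ab_group_add \<Rightarrow> 'v) \<Rightarrow> ('v \<Rightarrow> 'v) \<Rightarrow> 'a poly \<Rightarrow> bool" where
  "is_minimal_poly scale u m \<longleftrightarrow>
     lead_coeff m = 1 \<and> (\<forall>f. annihilates scale f u \<longleftrightarrow> m dvd f)"

definition ordered_basis ::
  "('a::field \<Rightarrow> 'v::ab_group_add \<Rightarrow> 'v) \<Rightarrow> 'v list \<Rightarrow> bool" where
  "ordered_basis scale bs \<longleftrightarrow>
     distinct bs \<and> \<not> module.dependent scale (set bs) \<and> module.span scale (set bs) = UNIV"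

text \<open>Column \<open>j\<close> of \<open>A\<close> holds the coordinates of \<open>u (bs ! j)\<close> in the basis \<open>bs\<close>.\<close>
definition represented_by ::
  "('a::field \<Rightarrow> 'v::ab_group_add \<Rightarrow> 'v) \<Rightarrow> 'v list \<Rightarrow> ('v \<Rightarrow> 'v) \<Rightarrow> 'a mat \<Rightarrow> bool" where
  "represented_by scale bs u A \<longleftrightarrow>
     A \<in> carrier_mat (length bs) (length bs) \<and>
     (\<forall>j<length bs. u (bs ! j) = (\<Sum>i<length bs. scale (A $$ (i, j)) (bs ! i)))"

text \<open>Eigenvalues in the algebraic closure are those of a representing matrix with entries
  mapped into the closure; they do not depend on the basis.\<close>
definition eigenvalue_ac ::
  "('a::field \<Rightarrow> 'v::ab_group_add \<Rightarrow> 'v) \<Rightarrow> ('v \<Rightarrow> 'v) \<Rightarrow> 'a alg_closure \<Rightarrow> bool" where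
  "eigenvalue_ac scale u x \<longleftrightarrow>
     (\<exists>bs A. ordered_basis scale bs \<and> represented_by scale bs u A \<and>
        eigenvalue (map_mat to_ac A) x)"

definition pq_difference ::
  "('a::field \<Rightarrow> 'v::ab_group_add \<Rightarrow> 'v) \<Rightarrow> 'a poly \<Rightarrow> 'a poly \<Rightarrow> ('v \<Rightarrow> 'v) \<Rightarrow> bool" where
  "pq_difference scale p q u \<longleftrightarrow>
     (\<exists>a b. Vector_Spaces.linear scale scale a \<and> Vector_Spaces.linear scale scale b \<and>
        annihilates scale p a \<and> annihilates scale q b \<and> (\<forall>v. u v = a v - b v))"

definition d_exceptional ::
  "('a::field \<Rightarrow> 'v::ab_group_add \<Rightarrow> 'v) \<Rightarrow> 'a poly \<Rightarrow> 'a poly \<Rightarrow> ('v \<Rightarrow> 'v) \<Rightarrow> bool" where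
  "d_exceptional scale p q u \<longleftrightarrow>
     (\<forall>z. eigenvalue_ac scale u z \<longrightarrow> z \<in> {x - y | x y. x \<in> Root p \<and> y \<in> Root q})"

end

theory Submission
  imports Defs
begin

text \<open>Put \<open>P = p(t + y)\<close>, which is irreducible. In both cases of the hypothesis
  \<open>Root p - Root q\<close> is the set of roots of \<open>P\<close>, so \<open>u\<close> is d-exceptional iff some power of \<open>P\<close>
  annihilates it, and then \<open>V\<close> is a direct sum of cyclic modules \<open>F[t]/(P ^ n)\<close>. It remains to see that
  such a \<open>u\<close> is a \<open>(p, q)\<close>-difference, for which it suffices to find an operator \<open>N\<close> on \<open>F[t]\<close> that
  preserves all ideals \<open>(P ^ n)\<close>, such that \<open>y + N\<close> is annihilated by \<open>q\<close> and \<open>t + N\<close> by \<open>P\<close>.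
  If \<open>q\<close> has a double root, \<open>N = - P \<delta>\<close> works, where \<open>\<delta>\<close> is the \<open>F[P]\<close>-linear map with
  \<open>\<delta> 1 = 0\<close> and \<open>\<delta> t = 1\<close>, because \<open>\<delta> \<circ> \<delta> = 0\<close>; in characteristic 2 with equal traces,
  \<open>N = P d/dt\<close> works, because the square of \<open>d/dt\<close> vanishes.\<close>

section \<open>Ideals and irreducible polynomials\<close>

text \<open>An element of least degree, made monic, divides all others, since the remainder of a
  division by it stays in the ideal. This serves for the ideal generated by two polynomials, for the
  annihilator of \<open>u\<close> and for the annihilator of a single vector.\<close>

lemma poly_ideal_principal:
  fixes I :: "'a::field poly set"
  assumes add: "\<And>f g. f \<in> I \<Longrightarrow> g \<in> I \<Longrightarrow> f + g \<in> I"
    and mult: "\<And>f g. g \<in> I \<Longrightarrow> f * g \<in> I"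
    and nz: "f0 \<in> I" "f0 \<noteq> 0"
  obtains m where "lead_coeff m = 1" "\<And>f. f \<in> I \<longleftrightarrow> m dvd f"
proof -
  obtain g where g: "g \<in> I" "g \<noteq> 0" and least: "\<And>h. h \<in> I \<Longrightarrow> h \<noteq> 0 \<Longrightarrow> degree g \<le> degree h"
    using arg_min_natI[of "\<lambda>g. g \<in> I \<and> g \<noteq> 0" f0 degree]
      arg_min_nat_le[of "\<lambda>g. g \<in> I \<and> g \<noteq> 0" _ degree] nz by blast
  define m where "m = smult (inverse (lead_coeff g)) g"
  have m: "m \<in> I" using mult[OF g(1), of "[:inverse (lead_coeff g):]"] by (simp add: m_def)
  have "m dvd f" if "f \<in> I" for f
  proof -
    have "f mod m = f + (- (f div m)) * m"
      using div_mult_mod_eq[of f m] by (simp add: algebra_simps)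
    hence "f mod m \<in> I" using add[OF that mult[OF m]] by metis
    moreover have "f mod m = 0 \<or> degree (f mod m) < degree m"
      using degree_mod_less[of m f] g(2) by (auto simp: m_def)
    moreover have "degree m = degree g" using g(2) by (simp add: m_def)
    ultimately have "f mod m = 0" using least[of "f mod m"] by force
    thus ?thesis by auto
  qed
  moreover have "f \<in> I" if "m dvd f" for f
    using that mult[OF m] by (metis dvd_def mult.commute)
  ultimately have "f \<in> I \<longleftrightarrow> m dvd f" for f by blast
  moreover have "lead_coeff m = 1" using g(2) by (simp add: m_def)
  ultimately show ?thesis by (rule that[rotated])
qed

text \<open>The generator of the ideal spanned by \<open>g\<close> and \<open>P\<close> divides
  \<open>P\<close>. Were it not a unit, \<open>P\<close> would divide it and hence also
  \<open>g\<close>.\<close>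

lemma bezout_irreducible:
  fixes P g :: "'a::field poly"
  assumes "irreducible P" "\<not> P dvd g"
  shows "\<exists>a b. a * g + b * P = 1"
proof -
  define I where "I = {a * g + b * P | a b. True}"
  have gI: "g \<in> I" and PI: "P \<in> I"
  proof -
    have "g = 1 * g + 0 * P" "P = 0 * g + 1 * P" by simp_all
    thus "g \<in> I" "P \<in> I" unfolding I_def by blast+
  qed
  obtain m where m: "\<And>f. f \<in> I \<longleftrightarrow> m dvd f"
  proof (rule poly_ideal_principal[of I])
    show "f + h \<in> I" if "f \<in> I" "h \<in> I" for f h
    proof -
      from that obtain a b c d where "f = a * g + b * P" "h = c * g + d * P" unfolding I_def by blast
      hence "f + h = (a + c) * g + (b + d) * P" by (simp add: algebra_simps)
      thus ?thesis unfolding I_def by blast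
    qed
    show "f * h \<in> I" if "h \<in> I" for f h
    proof -
      from that obtain a b where "h = a * g + b * P" unfolding I_def by blast
      hence "f * h = (f * a) * g + (f * b) * P" by (simp add: algebra_simps)
      thus ?thesis unfolding I_def by blast
    qed
    show "P \<in> I" "P \<noteq> 0" using PI assms(1) by auto
  qed blast
  have "is_unit m"
  proof (rule ccontr)
    assume "\<not> is_unit m"
    hence "P dvd m"
      using m PI assms(1) by (metis irreducibleD' )
    thus False using m gI assms(2) dvd_trans by blast
  qed
  hence "1 \<in> I" using m by blast
  thus ?thesis unfolding I_def by auto
qed

text \<open>The relation for \<open>P ^ n\<close> is multiplied by the one for \<open>P\<close>;
  every term of the product without \<open>P ^ Suc n\<close> contains \<open>g\<close>.\<close>

lemma bezout_irreducible_power: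
  fixes P g :: "'a::field poly"
  assumes "irreducible P" "\<not> P dvd g"
  shows "\<exists>a b. a * g + b * P ^ n = 1"
proof (induction n)
  case 0
  show ?case by (rule exI[of _ 0], rule exI[of _ 1]) simp
next
  case (Suc n)
  then obtain a b where ab: "a * g + b * P ^ n = 1" by blast
  obtain c d where cd: "c * g + d * P = 1" using bezout_irreducible[OF assms] by blast
  have "(a * (c * g + d * P) + b * P ^ n * c) * g + (b * d) * P ^ Suc n
      = (a * g + b * P ^ n) * (c * g + d * P)" by (simp add: algebra_simps)
  thus ?case using ab cd by (metis mult_1)
qed

lemma monic_is_unit:
  fixes m :: "'a::field poly"
  assumes "lead_coeff m = 1" "is_unit m"
  shows "m = 1"
  using is_unit_polyE[OF assms(2)] assms(1) by (metis degree_pCons_0 coeff_pCons_0 one_pCons)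

text \<open>Either a factor \<open>P\<close> can be split off from \<open>m\<close>, or
  \<open>m\<close> is coprime to the power of \<open>P\<close> that it divides, hence a unit and
  equal to 1.\<close>

lemma monic_dvd_irreducible_power:
  fixes P m :: "'a::field poly"
  assumes "irreducible P" "lead_coeff P = 1" "lead_coeff m = 1" "m dvd P ^ n"
  shows "\<exists>k. m = P ^ k"
  using assms(3,4)
proof (induction n arbitrary: m)
  case 0
  hence "m = 1" by (intro monic_is_unit) auto
  thus ?case by (metis power_0)
next
  case (Suc n)
  show ?case
  proof (cases "P dvd m")
    case True
    then obtain m' where m': "m = P * m'" by blast
    have "P \<noteq> 0" using assms(2) by auto
    hence "m' dvd P ^ n" using Suc.prems(2) m' by simp
    moreover have "lead_coeff m' = 1" using Suc.prems(1) assms(2) m' by (simp add: lead_coeff_mult)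
    ultimately obtain k where "m' = P ^ k" using Suc.IH by blast
    thus ?thesis using m' by (metis power_Suc)
  next
    case False
    obtain a b where "a * m + b * P ^ Suc n = 1" using bezout_irreducible_power[OF assms(1) False] by blast
    moreover have "m dvd a * m + b * P ^ Suc n" using Suc.prems(2) by (intro dvd_add dvd_mult) auto
    ultimately have "is_unit m" by simp
    hence "m = 1" using Suc.prems(1) monic_is_unit by blast
    thus ?thesis by (metis power_0)
  qed
qed

lemma is_unit_pcompose: "is_unit f \<Longrightarrow> is_unit (pcompose f g)" for f g :: "'a::field poly"
  by (metis dvd_def pcompose_1 pcompose_mult)

text \<open>The substitution of \<open>t + y\<close> for \<open>t\<close> is a ring automorphism
  with inverse \<open>t - y\<close>, so factorizations can be carried back.\<close>

lemma irreducible_pcompose_shift: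
  fixes p :: "'a::field poly"
  assumes "irreducible p"
  shows "irreducible (pcompose p [:y, 1:])"
proof (rule irreducibleI)
  have inv: "pcompose (pcompose f [:y, 1:]) [:- y, 1:] = f"
    "pcompose (pcompose f [:- y, 1:]) [:y, 1:] = f" for f
    by (simp_all add: pcompose_pCons flip: pcompose_assoc)
  show "pcompose p [:y, 1:] \<noteq> 0" using inv(1)[of p] assms by auto
  show "\<not> is_unit (pcompose p [:y, 1:])"
    using is_unit_pcompose[of "pcompose p [:y, 1:]" "[:- y, 1:]"] inv(1)[of p] assms by (auto simp: irreducible_def)
  fix a b assume "pcompose p [:y, 1:] = a * b"
  hence "p = pcompose a [:- y, 1:] * pcompose b [:- y, 1:]"
    using inv(1)[of p] by (simp add: pcompose_mult)
  hence "is_unit (pcompose a [:- y, 1:]) \<or> is_unit (pcompose b [:- y, 1:])"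
    using assms irreducibleD by blast
  thus "is_unit a \<or> is_unit b"
    using is_unit_pcompose inv(2) by metis
qed

section \<open>The module defined by an endomorphism\<close>

locale endo_space = finite_dimensional_vector_space scale Basis
  for scale :: "'a::field \<Rightarrow> 'v::ab_group_add \<Rightarrow> 'v" (infixr \<open>*s\<close> 75) and Basis +
  fixes u :: "'v \<Rightarrow> 'v"
  assumes linear_u: "Vector_Spaces.linear scale scale u"
begin

sublocale u: Vector_Spaces.linear scale scale u by (rule linear_u)

abbreviation act :: "'a poly \<Rightarrow> 'v \<Rightarrow> 'v" where
  "act f \<equiv> poly_endo scale f u"

lemma act_eq_sum:
  assumes "degree f \<le> n"
  shows "act f v = (\<Sum>i\<le>n. coeff f i *s (u ^^ i) v)"
  unfolding poly_endo_def using assms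
  by (intro sum.mono_neutral_left) (auto simp: coeff_eq_0)

lemma act_0 [simp]: "act 0 v = 0"
  by (simp add: poly_endo_def)

lemma act_pCons: "act (pCons a f) v = a *s v + u (act f v)"
proof -
  have "act (pCons a f) v = (\<Sum>i\<le>Suc (degree f). coeff (pCons a f) i *s (u ^^ i) v)"
    by (rule act_eq_sum) (simp add: degree_pCons_le)
  also have "\<dots> = a *s v + (\<Sum>i\<le>degree f. coeff f i *s (u ^^ Suc i) v)"
    by (subst sum.atMost_Suc_shift) simp
  also have "(\<Sum>i\<le>degree f. coeff f i *s (u ^^ Suc i) v) = u (act f v)"
    unfolding poly_endo_def 
    by (simp add: u.sum u.scale)
  finally show ?thesis .
qed

lemma linear_act: "Vector_Spaces.linear scale scale (act f)"
proof (induction f)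
  case 0
  show ?case by (simp add: Vector_Spaces.linear_iff vector_space_axioms)
next
  case (pCons a f)
  interpret f: Vector_Spaces.linear scale scale "act f" by fact
  show ?case
    by (simp add: Vector_Spaces.linear_iff vector_space_axioms act_pCons f.add f.scale u.add u.scale scale_right_distrib mult.commute)
qed

lemma act_add: "act (f + g) v = act f v + act g v"
proof -
  define n where "n = max (degree f) (degree g)"
  have "degree (f + g) \<le> n" by (simp add: n_def degree_add_le)
  thus ?thesis by (simp add: act_eq_sum[of _ n] n_def scale_left_distrib sum.distrib)
qed

lemma act_smult: "act (smult c f) v = c *s act f v"
  by (simp add: act_eq_sum[of "smult c f" "degree f"] poly_endo_def[of scale f] scale_sum_right)

lemma act_mult: "act (f * g) v = act f (act g v)"
proof (induction f arbitrary: v)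
  case (pCons a f)
  thus ?case by (simp add: act_add act_smult act_pCons)
qed simp

lemma act_1 [simp]: "act 1 v = v"
  by (simp add: poly_endo_def)

text \<open>The space becomes a module over F[t] in which \<open>t\<close> acts as \<open>u\<close>.
  From here on \<open>pm.span\<close> is the generated F[t]-submodule, while \<open>span\<close>
  remains the F-subspace.\<close>

sublocale pm: Modules.module "\<lambda>f. poly_endo scale f u"
proof
  interpret f: Vector_Spaces.linear scale scale "act f" for f by (rule linear_act)
  show "act f (x + y) = act f x + act f y" for f x y by (rule f.add)
qed (simp_all add: act_add act_mult)

lemma act_monom: "act (monom c n) v = c *s (u ^^ n) v"
proof -
  have "(\<Sum>i\<le>n. coeff (monom c n) i *s (u ^^ i) v) = (\<Sum>i\<le>n. if i = n then c *s (u ^^ n) v else 0)"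
    by (intro sum.cong) auto
  thus ?thesis by (simp add: act_eq_sum[of _ n] degree_monom_le)
qed

lemma act_X: "act [:0, 1:] v = u v"
  by (simp add: act_pCons u.zero)

lemma act_commute: "act f (act g v) = act g (act f v)"
  by (metis act_mult mult.commute)

lemma act_const: "act [:c:] v = c *s v"
  by (simp add: act_pCons u.zero)

end

section \<open>Cyclic decomposition\<close>

context endo_space begin

text \<open>Constant polynomials act as scalars, so each F[t]-submodule is a subspace. In particular
  a basis of the space generates it over F[t].\<close>

lemma span_subset_pm_span: "span A \<subseteq> pm.span A"
proof (rule span_minimal)
  show "A \<subseteq> pm.span A" by (rule pm.span_superset)
  show "subspace (pm.span A)"
  proof (rule subspaceI)
    fix c x assume "x \<in> pm.span A"
    thus "c *s x \<in> pm.span A" using pm.span_scale[of x A "[:c:]"] by (simp add: act_const)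
  qed (auto intro: pm.span_zero pm.span_add)
qed

text \<open>A generating set for which the sum of the exponents \<open>ord v\<close> is minimal is independent: a
  nontrivial relation can be divided by its largest common power \<open>P ^ e\<close>, and then the resulting
  combination \<open>w\<close>, which is killed by \<open>P ^ e\<close>, can replace one of the generators.\<close>
lemma cyclic_decomposition:
  fixes P :: "'a poly"
  assumes irr: "irreducible P" and ann: "annihilates scale (P ^ k) u"
  obtains S :: "'v set" and n :: "'v \<Rightarrow> nat"
  where "finite S" "pm.span S = UNIV"
    "\<forall>v\<in>S. 0 < n v \<and> act (P ^ n v) v = 0"
    "\<forall>f. (\<Sum>v\<in>S. act (f v) v) = 0 \<longrightarrow> (\<forall>v\<in>S. P ^ n v dvd f v)"
proof -
  define ord where "ord v = (LEAST i. act (P ^ i) v = 0)" for v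
  have ord: "act (P ^ ord v) v = 0" for v
    unfolding ord_def by (rule LeastI[of _ k]) (use ann in \<open>simp add: annihilates_def\<close>)
  have ord_le: "ord v \<le> i" if "act (P ^ i) v = 0" for v i
    unfolding ord_def using that by (rule Least_le)
  define good where "good S \<longleftrightarrow> finite S \<and> 0 \<notin> S \<and> pm.span S = UNIV" for S
  have span_minus_0: "pm.span (A - {0}) = pm.span A" for A
  proof
    show "pm.span A \<subseteq> pm.span (A - {0})"
      by (rule pm.span_minimal) (auto intro: pm.span_base pm.span_zero)
  qed (rule pm.span_mono, blast)
  have "pm.span Basis = UNIV" using span_subset_pm_span[of Basis] span_Basis by auto
  hence "good (Basis - {0})" using finite_Basis by (simp add: good_def span_minus_0)
  then obtain S where S: "good S" and least: "\<And>T. good T \<Longrightarrow> sum ord S \<le> sum ord T"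
    using arg_min_natI[of good _ "sum ord"] arg_min_nat_le[of good _ "sum ord"] by metis
  have fin: "finite S" and S0: "0 \<notin> S" and spanS: "pm.span S = UNIV"
    using S by (simp_all add: good_def)
  have "P ^ ord v dvd f v" if rel: "(\<Sum>v\<in>S. act (f v) v) = 0" and v: "v \<in> S" for f v
  proof (rule ccontr)
    assume ndvd: "\<not> P ^ ord v dvd f v"
    \<comment> \<open>Outside \<open>T\<close> the terms of the relation vanish because
      \<open>P ^ ord z\<close> kills \<open>z\<close>; only \<open>T\<close> matters in what
      follows.\<close>
    define T where "T = {v \<in> S. \<not> P ^ ord v dvd f v}"
    have finT: "finite T" using fin by (simp add: T_def)
    define Q where "Q i \<longleftrightarrow> (\<exists>z\<in>T. \<not> P ^ Suc i dvd f z)" for i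
    \<comment> \<open>The largest exponent for which \<open>P ^ e\<close> divides \<open>f z\<close>
      for all \<open>z\<close> in \<open>T\<close>; at \<open>x\<close> the next power
      fails.\<close>
    define e where "e = (LEAST i. Q i)"
    have "v \<in> T" using v ndvd by (simp add: T_def)
    \<comment> \<open>The truncated subtraction is harmless: \<open>ord v\<close> is not 0, since
      \<open>P ^ 0 = 1\<close> divides everything.\<close>
    moreover have "Suc (ord v - 1) = ord v" using ndvd by (cases "ord v = 0") auto
    ultimately have "Q (ord v - 1)" using ndvd unfolding Q_def by metis
    hence "Q e" unfolding e_def by (rule LeastI)
    then obtain x where x: "x \<in> T" "\<not> P ^ Suc e dvd f x" unfolding Q_def by blast
    define h where "h z = f z div P ^ e" for z
    have f_eq: "f z = P ^ e * h z" if "z \<in> T" for z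
    proof -
      have "P ^ e dvd f z"
      proof (cases e)
        case (Suc i)
        hence "\<not> Q i" using not_less_Least[of i Q] by (simp add: e_def)
        thus ?thesis using that Suc unfolding Q_def by blast
      qed simp
      thus ?thesis by (simp add: h_def)
    qed
    have "\<not> P dvd h x"
    proof
      assume "P dvd h x"
      hence "P ^ e * P dvd P ^ e * h x" by (rule mult_dvd_mono[OF dvd_refl])
      thus False using f_eq[OF x(1)] x(2) by (simp add: mult.commute)
    qed
    \<comment> \<open>As \<open>P ^ k\<close> kills the whole space, \<open>a\<close> acts as an
      inverse of \<open>h x\<close>. This recovers \<open>x\<close> from \<open>w\<close> and the
      remaining generators.\<close>
    then obtain a b where ab: "a * h x + b * P ^ k = 1"
      using bezout_irreducible_power[OF irr] by blast
    have e_less: "e < ord x"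
    proof (rule ccontr)
      assume "\<not> e < ord x"
      hence "P ^ ord x dvd P ^ e" by (simp add: le_imp_power_dvd)
      thus False using f_eq[OF x(1)] x(1) dvd_trans unfolding T_def by fastforce
    qed
    define w where "w = (\<Sum>z\<in>T. act (h z) z)"
    have "act (P ^ e) w = (\<Sum>z\<in>T. act (f z) z)"
      unfolding w_def pm.scale_sum_right by (intro sum.cong) (simp_all add: f_eq)
    also have "\<dots> = (\<Sum>z\<in>S. act (f z) z)"
    proof (rule sum.mono_neutral_left)
      show "\<forall>z\<in>S - T. act (f z) z = 0"
      proof
        fix z assume "z \<in> S - T"
        hence "P ^ ord z dvd f z" by (simp add: T_def)
        then obtain g where "f z = g * P ^ ord z" by (metis dvd_def mult.commute)
        thus "act (f z) z = 0" using act_mult[of g "P ^ ord z" z] ord by simp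
      qed
    qed (use fin in \<open>auto simp: T_def\<close>)
    finally have w: "act (P ^ e) w = 0" using rel by simp
    \<comment> \<open>The vector \<open>w\<close> takes the place of \<open>x\<close>. It may be
      zero or already a generator, which can only lower the sum of the exponents; the strict
      decrease comes from \<open>ord w \<le> e < ord x\<close>.\<close>
    define S' where "S' = insert w (S - {x}) - {0}"
    have xS: "x \<in> S" using x(1) by (simp add: T_def)
    have "x \<in> pm.span (insert w (S - {x}))" (is "_ \<in> ?W")
    proof -
      have "w = act (h x) x + (\<Sum>z\<in>T - {x}. act (h z) z)"
        unfolding w_def using finT x(1) by (simp add: sum.remove)
      hence "act (h x) x = w - (\<Sum>z\<in>T - {x}. act (h z) z)" by simp
      also have "\<dots> \<in> ?W"
        by (intro pm.span_diff pm.span_sum pm.span_scale pm.span_base) (auto simp: T_def)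
      finally have "act a (act (h x) x) \<in> ?W" by (rule pm.span_scale)
      moreover have "act a (act (h x) x) = act (a * h x + b * P ^ k) x"
        using ann act_mult[of b "P ^ k" x] by (simp add: act_add annihilates_def)
      ultimately show ?thesis by (simp add: ab)
    qed
    hence "S \<subseteq> ?W" by (auto intro: pm.span_base)
    hence "pm.span S \<subseteq> ?W" by (rule pm.span_minimal) simp
    hence "good S'" using spanS fin by (auto simp: good_def S'_def span_minus_0)
    hence "sum ord S \<le> sum ord S'" by (rule least)
    also have "\<dots> \<le> sum ord (insert w (S - {x}))"
      unfolding S'_def using fin by (intro sum_mono2) auto
    also have "\<dots> \<le> ord w + sum ord (S - {x})"
      using fin by (simp add: sum.insert_if)
    also have "\<dots> < ord x + sum ord (S - {x})"
      using ord_le[OF w] e_less by simp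
    also have "\<dots> = sum ord S" using fin xS by (simp add: sum.remove)
    finally show False by simp
  qed
  moreover have "0 < ord v" if "v \<in> S" for v
    using ord[of v] that S0 by (cases "ord v = 0") auto
  ultimately show ?thesis using fin spanS ord by (intro that[of S ord]) simp_all
qed

end

section \<open>Companion matrices\<close>

lemma sum_lessThan_add_split:
  fixes g :: "nat \<Rightarrow> 'b::comm_monoid_add"
  shows "(\<Sum>i<m + n. g i) = (\<Sum>i<m. g i) + (\<Sum>i<n. g (m + i))"
  by (induction n) (simp_all add: add.assoc)

text \<open>Passes from a free family to an independent set. A collision \<open>g i = g j\<close>
  would give a relation with coefficients 1 and -1, so the family is injective and relations among
  its values can be reindexed.\<close>

lemma (in vector_space) independent_image:
  assumes fin: "finite I" and free: "\<And>c i. (\<Sum>i\<in>I. scale (c i) (g i)) = 0 \<Longrightarrow> i \<in> I \<Longrightarrow> c i = 0"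
  shows "inj_on g I" "independent (g ` I)"
proof -
  show inj: "inj_on g I"
  proof (rule inj_onI, rule ccontr)
    fix i j assume ij: "i \<in> I" "j \<in> I" "g i = g j" "i \<noteq> j"
    define c :: "_ \<Rightarrow> 'a" where "c k = (if k = i then 1 else 0) - (if k = j then 1 else 0)" for k
    have "(\<Sum>k\<in>I. scale (c k) (g k)) = (\<Sum>k\<in>I. if k = i then g k else 0) - (\<Sum>k\<in>I. if k = j then g k else 0)"
      unfolding sum_subtractf[symmetric] by (intro sum.cong) (auto simp: c_def scale_left_diff_distrib)
    also have "\<dots> = 0" using fin ij by simp
    finally have "c i = 0" using free ij(1) by blast
    thus False using ij(4) by (simp add: c_def)
  qed
  show "independent (g ` I)"
  proof (subst independent_explicit_module, intro allI impI)
    fix t c w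
    assume t: "finite t" "t \<subseteq> g ` I" and sum0: "(\<Sum>v\<in>t. scale (c v) v) = 0" and w: "w \<in> t"
    define d where "d i = (if g i \<in> t then c (g i) else 0)" for i
    have "(\<Sum>i\<in>I. scale (d i) (g i)) = (\<Sum>v\<in>g ` I. scale (if v \<in> t then c v else 0) v)"
      by (simp add: sum.reindex[OF inj] d_def)
    also have "\<dots> = (\<Sum>v\<in>t. scale (c v) v)"
      using t fin by (intro sum.mono_neutral_cong_right) auto
    finally have *: "(\<Sum>i\<in>I. scale (d i) (g i)) = 0" using sum0 by simp
    obtain i where "i \<in> I" "w = g i" using t w by blast
    thus "c w = 0" using free[OF *, of i] w by (simp add: d_def)
  qed
qed

lemma companion_mat_carrier: "companion_mat r \<in> carrier_mat (degree r) (degree r)"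
  by (simp add: companion_mat_def)

context endo_space begin

text \<open>With zero off-diagonal blocks, each column involves the vectors of its own block alone.
  The zero blocks are sized as in the recursion of \<open>diag_block_mat\<close>.\<close>

lemma represented_by_append:
  assumes A: "A \<in> carrier_mat (length xs) (length xs)" and B: "B \<in> carrier_mat (length ys) (length ys)"
  shows "represented_by scale (xs @ ys) u
      (four_block_mat A (0\<^sub>m (dim_row A) (dim_col B)) (0\<^sub>m (dim_row B) (dim_col A)) B)
    \<longleftrightarrow> represented_by scale xs u A \<and> represented_by scale ys u B"
proof -
  define F where "F = four_block_mat A (0\<^sub>m (dim_row A) (dim_col B)) (0\<^sub>m (dim_row B) (dim_col A)) B"
  have left: "(\<Sum>i<length (xs @ ys). F $$ (i, j) *s (xs @ ys) ! i) = (\<Sum>i<length xs. A $$ (i, j) *s xs ! i)"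
    if "j < length xs" for j
    using A B that by (simp add: sum_lessThan_add_split F_def nth_append)
  have right: "(\<Sum>i<length (xs @ ys). F $$ (i, length xs + j) *s (xs @ ys) ! i) = (\<Sum>i<length ys. B $$ (i, j) *s ys ! i)"
    if "j < length ys" for j
    using A B that by (simp add: sum_lessThan_add_split F_def nth_append)
  have all_split: "(\<forall>j<m + n. R j) \<longleftrightarrow> (\<forall>j<m. R j) \<and> (\<forall>j<n. R (m + j))" for R and m n :: nat
    by (metis add_less_cancel_left le_add_diff_inverse not_less trans_less_add1)
  have "F \<in> carrier_mat (length (xs @ ys)) (length (xs @ ys))" using A B by (simp add: F_def)
  thus ?thesis unfolding F_def[symmetric] represented_by_def
    using A B left right by (simp add: all_split nth_append)
qed

text \<open>All columns but the last say that \<open>u\<close> maps each vector of the list to the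
  next one, so the list is an orbit of its first vector \<open>v\<close>. Given this, the last
  column says that \<open>r\<close> kills \<open>v\<close>.\<close>

lemma represented_by_companion_mat:
  assumes monic: "lead_coeff r = 1" and deg: "0 < degree r"
  shows "represented_by scale bs u (companion_mat r) \<longleftrightarrow>
    (\<exists>v. bs = map (\<lambda>j. (u ^^ j) v) [0..<degree r] \<and> act r v = 0)"
proof -
  let ?d = "degree r"
  have act_r: "act r v = (\<Sum>i<?d. coeff r i *s (u ^^ i) v) + (u ^^ ?d) v" for v
    using monic by (simp add: poly_endo_def flip: lessThan_Suc_atMost)
  have last: "(\<Sum>i<?d. companion_mat r $$ (i, ?d - 1) *s f i) = - (\<Sum>i<?d. coeff r i *s f i)" for f
    using deg by (simp add: companion_mat_def sum_negf)
  have other: "(\<Sum>i<?d. companion_mat r $$ (i, j) *s f i) = f (Suc j)" if "Suc j < ?d" for j f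
  proof -
    have "(\<Sum>i<?d. companion_mat r $$ (i, j) *s f i) = (\<Sum>i<?d. if i = Suc j then f i else 0)"
      using that by (intro sum.cong) (auto simp: companion_mat_def)
    thus ?thesis using that by simp
  qed
  show ?thesis
  proof
    assume rep: "represented_by scale bs u (companion_mat r)"
    hence len: "length bs = ?d" using companion_mat_carrier[of r] by (auto simp: represented_by_def)
    have cols: "u (bs ! j) = (\<Sum>i<?d. companion_mat r $$ (i, j) *s bs ! i)" if "j < ?d" for j
      using rep that by (simp add: represented_by_def len)
    have pow: "bs ! j = (u ^^ j) (bs ! 0)" if "j < ?d" for j
      using that
    proof (induction j)
      case (Suc j)
      thus ?case using cols[of j] other[of j "(!) bs"] by simp
    qed simp
    have "bs = map (\<lambda>j. (u ^^ j) (bs ! 0)) [0..<?d]"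
      by (rule nth_equalityI) (simp_all add: len, metis pow)
    moreover have "act r (bs ! 0) = 0"
    proof -
      have "(u ^^ ?d) (bs ! 0) = u (bs ! (?d - 1))"
        using deg pow[of "?d - 1"] by (cases ?d) auto
      also have "\<dots> = - (\<Sum>i<?d. coeff r i *s bs ! i)"
        using cols[of "?d - 1"] deg last[of "(!) bs"] by simp
      also have "(\<Sum>i<?d. coeff r i *s bs ! i) = (\<Sum>i<?d. coeff r i *s (u ^^ i) (bs ! 0))"
        by (intro sum.cong) (simp_all flip: pow)
      finally show ?thesis by (simp add: act_r)
    qed
    ultimately show "\<exists>v. bs = map (\<lambda>j. (u ^^ j) v) [0..<?d] \<and> act r v = 0" by blast
  next
    assume "\<exists>v. bs = map (\<lambda>j. (u ^^ j) v) [0..<?d] \<and> act r v = 0"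
    then obtain v where bs: "bs = map (\<lambda>j. (u ^^ j) v) [0..<?d]" and v: "act r v = 0" by blast
    have "u (bs ! j) = (\<Sum>i<?d. companion_mat r $$ (i, j) *s bs ! i)" if j: "j < ?d" for j
    proof -
      have "(\<Sum>i<?d. companion_mat r $$ (i, j) *s bs ! i) = (\<Sum>i<?d. companion_mat r $$ (i, j) *s (u ^^ i) v)"
        by (intro sum.cong) (auto simp: bs)
      also have "\<dots> = (u ^^ Suc j) v"
      proof (cases "Suc j < ?d")
        case True
        thus ?thesis by (simp add: other[of j "\<lambda>i. (u ^^ i) v"])
      next
        case False
        hence "j = ?d - 1" "Suc j = ?d" using j by auto
        moreover have "(u ^^ ?d) v = - (\<Sum>i<?d. coeff r i *s (u ^^ i) v)"
          using v unfolding act_r by (simp add: eq_neg_iff_add_eq_0 add.commute)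
        ultimately show ?thesis using last[of "\<lambda>i. (u ^^ i) v"] by simp
      qed
      finally show ?thesis using j by (simp add: bs)
    qed
    thus "represented_by scale bs u (companion_mat r)"
      using companion_mat_carrier[of r] by (simp add: represented_by_def bs)
  qed
qed

lemma represented_by_diag_companion_mat:
  assumes "\<And>r. r \<in> set rs \<Longrightarrow> lead_coeff r = 1 \<and> 0 < degree r"
  shows "represented_by scale bs u (diag_block_mat (map companion_mat rs)) \<longleftrightarrow>
    (\<exists>vs. list_all2 (\<lambda>r v. act r v = 0) rs vs \<and>
       bs = concat (map2 (\<lambda>r v. map (\<lambda>j. (u ^^ j) v) [0..<degree r]) rs vs))"
  using assms
proof (induction rs arbitrary: bs)
  case Nil
  thus ?case by (auto simp: represented_by_def)
next
  case (Cons r rs)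
  let ?A = "companion_mat r" and ?B = "diag_block_mat (map companion_mat rs)"
  let ?n = "sum_list (map degree rs)"
  have r: "lead_coeff r = 1" "0 < degree r" using Cons.prems by auto
  note A = companion_mat_carrier[of r]
  have B: "?B \<in> carrier_mat ?n ?n"
  proof -
    have "map dim_row (map companion_mat rs) = map degree rs" "map dim_col (map companion_mat rs) = map degree rs"
      by (simp_all add: companion_mat_def)
    thus ?thesis by (simp only: carrier_mat_def mem_Collect_eq dim_diag_block_mat)
  qed
  have IH: "represented_by scale ys u ?B \<longleftrightarrow> (\<exists>vs. list_all2 (\<lambda>r v. act r v = 0) rs vs \<and>
       ys = concat (map2 (\<lambda>r v. map (\<lambda>j. (u ^^ j) v) [0..<degree r]) rs vs))" for ys
    by (rule Cons.IH) (use Cons.prems in auto)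
  have "represented_by scale bs u (diag_block_mat (map companion_mat (r # rs))) \<longleftrightarrow>
    (\<exists>xs ys. bs = xs @ ys \<and> represented_by scale xs u ?A \<and> represented_by scale ys u ?B)" (is "?L \<longleftrightarrow> ?R")
  proof
    assume L: ?L
    hence "length bs = degree r + ?n" using A B by (auto simp: represented_by_def Let_def)
    moreover have "bs = take (degree r) bs @ drop (degree r) bs" by simp
    ultimately show ?R
      using L represented_by_append[of ?A "take (degree r) bs" ?B "drop (degree r) bs"] A B
      by (metis (no_types, lifting) add_diff_cancel_left' diag_block_mat.simps(2) le_add1 length_drop length_take list.map(2) min.absorb2)
  next
    assume ?R
    then obtain xs ys where *: "bs = xs @ ys" "represented_by scale xs u ?A" "represented_by scale ys u ?B" by blast
    hence "?A \<in> carrier_mat (length xs) (length xs)" "?B \<in> carrier_mat (length ys) (length ys)"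
      by (simp_all add: represented_by_def)
    thus ?L using * represented_by_append by (simp add: Let_def)
  qed
  also have "\<dots> \<longleftrightarrow> (\<exists>v vs. act r v = 0 \<and> list_all2 (\<lambda>r v. act r v = 0) rs vs \<and>
      bs = map (\<lambda>j. (u ^^ j) v) [0..<degree r] @ concat (map2 (\<lambda>r v. map (\<lambda>j. (u ^^ j) v) [0..<degree r]) rs vs))"
    unfolding represented_by_companion_mat[OF r] IH by blast
  also have "\<dots> \<longleftrightarrow> (\<exists>vs. list_all2 (\<lambda>r v. act r v = 0) (r # rs) vs \<and>
       bs = concat (map2 (\<lambda>r v. map (\<lambda>j. (u ^^ j) v) [0..<degree r]) (r # rs) vs))"
    (is "?A \<longleftrightarrow> ?B")
  proof
    assume ?A
    then obtain v vs where "act r v = 0" "list_all2 (\<lambda>r v. act r v = 0) rs vs"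
      "bs = map (\<lambda>j. (u ^^ j) v) [0..<degree r] @ concat (map2 (\<lambda>r v. map (\<lambda>j. (u ^^ j) v) [0..<degree r]) rs vs)"
      by blast
    thus ?B by (intro exI[of _ "v # vs"]) simp
  next
    assume ?B
    then obtain v vs where "act r v = 0" "list_all2 (\<lambda>r v. act r v = 0) rs vs"
      "bs = concat (map2 (\<lambda>r v. map (\<lambda>j. (u ^^ j) v) [0..<degree r]) (r # rs) (v # vs))"
      unfolding list_all2_Cons1 by blast
    thus ?A by (intro exI[of _ v] exI[of _ vs]) simp
  qed
  finally show ?case .
qed

text \<open>The hypotheses present the space as the direct sum of the cyclic modules F[t]/(r v).
  Division with remainder by \<open>r v\<close> gives spanning. For independence, a linear relation
  yields polynomials of degree below \<open>degree (r v)\<close> that \<open>r v\<close> divides, so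
  they vanish.\<close>

lemma ordered_basis_cyclic:
  assumes dist: "distinct vs" and spn: "pm.span (set vs) = UNIV"
    and nz: "\<And>v. v \<in> set vs \<Longrightarrow> r v \<noteq> 0"
    and ann: "\<And>v. v \<in> set vs \<Longrightarrow> act (r v) v = 0"
    and rel: "\<And>f v. (\<Sum>v\<in>set vs. act (f v) v) = 0 \<Longrightarrow> v \<in> set vs \<Longrightarrow> r v dvd f v"
  shows "ordered_basis scale (concat (map (\<lambda>v. map (\<lambda>j. (u ^^ j) v) [0..<degree (r v)]) vs))"
proof -
  \<comment> \<open>Indexing by pairs \<open>(v, j)\<close> allows freeness to be proved first;
    distinctness of the vectors is then a consequence.\<close>
  define idx where "idx = concat (map (\<lambda>v. map (Pair v) [0..<degree (r v)]) vs)"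
  define g where "g = (\<lambda>(v, j). (u ^^ j) v)"
  define bs where "bs = concat (map (\<lambda>v. map (\<lambda>j. (u ^^ j) v) [0..<degree (r v)]) vs)"
  define I where "I = Sigma (set vs) (\<lambda>v. {..<degree (r v)})"
  have bs: "bs = map g idx" by (simp add: bs_def idx_def map_concat g_def o_def)
  have set_idx: "set idx = I" by (auto simp: idx_def I_def)
  have dist_idx: "distinct idx"
    using dist unfolding idx_def by (induction vs) (auto simp: distinct_map inj_on_def)
  have finI: "finite I" by (simp add: I_def)
  have free: "c i = 0" if sum0: "(\<Sum>i\<in>I. c i *s g i) = 0" and i: "i \<in> I" for c i
  proof -
    define f where "f v = (\<Sum>j<degree (r v). monom (c (v, j)) j)" for v
    have "(\<Sum>v\<in>set vs. act (f v) v) = (\<Sum>v\<in>set vs. \<Sum>j<degree (r v). c (v, j) *s (u ^^ j) v)"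
      by (simp add: f_def pm.scale_sum_left act_monom)
    also have "\<dots> = (\<Sum>i\<in>I. c i *s g i)"
      unfolding I_def g_def by (subst sum.Sigma) (auto intro: sum.cong)
    finally have *: "(\<Sum>v\<in>set vs. act (f v) v) = 0" using sum0 by simp
    obtain v j where vj: "i = (v, j)" "v \<in> set vs" "j < degree (r v)" using i by (auto simp: I_def)
    have coeff_f: "coeff (f v) k = (if k < degree (r v) then c (v, k) else 0)" for k
      by (simp add: f_def coeff_sum)
    have "f v = 0"
    proof (rule ccontr)
      assume "f v \<noteq> 0"
      hence "degree (r v) \<le> degree (f v)" using rel[OF * vj(2)] by (rule dvd_imp_degree_le[rotated])
      thus False using coeff_f[of "degree (f v)"] \<open>f v \<noteq> 0\<close> by simp
    qed
    thus ?thesis using coeff_f[of j] vj by simp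
  qed
  have "pm.span (set vs) \<subseteq> span (set bs)"
  proof
    fix x assume "x \<in> pm.span (set vs)"
    then obtain f where x: "x = (\<Sum>v\<in>set vs. act (f v) v)" unfolding pm.span_finite[OF finite_set] by auto
    show "x \<in> span (set bs)" unfolding x
    proof (rule span_sum)
      fix v assume v: "v \<in> set vs"
      have "act (f v) v = act (f v div r v) (act (r v) v) + act (f v mod r v) v"
        by (metis act_add act_mult div_mult_mod_eq)
      also have "\<dots> = act (f v mod r v) v" using ann[OF v] by simp
      also have "\<dots> = (\<Sum>i\<le>degree (f v mod r v). coeff (f v mod r v) i *s (u ^^ i) v)"
        by (simp add: poly_endo_def)
      also have "\<dots> \<in> span (set bs)"
      proof (intro span_sum)
        fix i assume i: "i \<in> {..degree (f v mod r v)}"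
        show "coeff (f v mod r v) i *s (u ^^ i) v \<in> span (set bs)"
        proof (cases "f v mod r v = 0")
          case False
          hence "i < degree (r v)" using degree_mod_less[OF nz[OF v], of "f v"] i by auto
          hence "(u ^^ i) v \<in> set bs" using v unfolding bs_def by (auto intro!: bexI[of _ v])
          thus ?thesis by (intro span_scale span_base)
        qed (simp add: span_zero)
      qed
      finally show "act (f v) v \<in> span (set bs)" .
    qed
  qed
  moreover have "inj_on g I" by (rule independent_image(1)[OF finI]) (rule free)
  hence "distinct bs" using dist_idx set_idx by (simp add: bs distinct_map)
  moreover have "independent (g ` I)" by (rule independent_image(2)[OF finI]) (rule free)
  hence "independent (set bs)" by (simp add: bs set_idx)
  ultimately show ?thesis using spn unfolding ordered_basis_def bs_def[symmetric] by auto
qed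

end

section \<open>Eigenvalues and annihilating polynomials\<close>

interpretation ac: map_poly_inj_idom_hom to_ac
  by unfold_locales auto

text \<open>The companion matrix describes multiplication by \<open>t\<close> on F[t]/(r) in the
  basis of powers of \<open>t\<close>. Since \<open>(t - z) * g = r\<close> vanishes there, the
  coefficients of \<open>g\<close> form an eigenvector for \<open>z\<close>.\<close>

lemma companion_mat_eigenvector:
  fixes r :: "'a::field poly"
  assumes monic: "lead_coeff r = 1"
    and g: "map_poly to_ac r = [:- z, 1:] * g" and i: "i < degree r"
  shows "(\<Sum>j<degree r. to_ac (companion_mat r $$ (i, j)) * coeff g j) = z * coeff g i"
proof -
  let ?d = "degree r"
  have deg: "degree (map_poly to_ac r) = ?d" by simp
  have "g \<noteq> 0" using g monic by auto
  hence deg_g: "?d = Suc (degree g)" using deg unfolding g by (subst (asm) degree_mult_eq) auto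
  have "lead_coeff (map_poly to_ac r) = 1" using monic by simp
  \<comment> \<open>Thus the last column of the matrix contributes exactly
    \<open>- coeff r i\<close> to the sum.\<close>
  hence lead_g: "coeff g (degree g) = 1" unfolding g lead_coeff_mult by simp
  have coeff_r: "to_ac (coeff r k) = - z * coeff g k + (case k of 0 \<Rightarrow> 0 | Suc l \<Rightarrow> coeff g l)" for k
  proof -
    have "to_ac (coeff r k) = coeff ([:- z, 1:] * g) k" unfolding g[symmetric] by simp
    thus ?thesis by (cases k) auto
  qed
  have "(\<Sum>j<?d. to_ac (companion_mat r $$ (i, j)) * coeff g j)
      = (\<Sum>j<degree g. (if i = Suc j then coeff g j else 0)) - to_ac (coeff r i)"
    unfolding deg_g sum.lessThan_Suc using i deg_g lead_g
    by (auto simp: companion_mat_def intro!: sum.cong)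
  also have "(\<Sum>j<degree g. (if i = Suc j then coeff g j else 0)) = (case i of 0 \<Rightarrow> 0 | Suc l \<Rightarrow> coeff g l)"
    using i deg_g by (cases i) auto
  finally show ?thesis unfolding coeff_r by simp
qed

context endo_space begin

lemma annihilatesI_span:
  assumes "span A = UNIV" "\<And>a. a \<in> A \<Longrightarrow> act f a = 0"
  shows "annihilates scale f u"
proof -
  interpret f: Vector_Spaces.linear scale scale "act f" by (rule linear_act)
  show ?thesis unfolding annihilates_def
    using f.eq_0_on_span[of A] assms by blast
qed

text \<open>The \<open>card Basis + 1\<close> vectors \<open>(u ^^ i) v\<close> with
  \<open>i \<le> card Basis\<close> are too many to form a free family.\<close>

lemma exists_annihilating_vector_poly: "\<exists>f. f \<noteq> 0 \<and> act f v = 0"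
proof (rule ccontr)
  assume none: "\<not> ?thesis"
  let ?I = "{..card Basis}"
  have free: "c i = 0" if sum0: "(\<Sum>i\<in>?I. c i *s (u ^^ i) v) = 0" and i: "i \<in> ?I" for c i
  proof -
    have "act (\<Sum>i\<in>?I. monom (c i) i) v = 0"
      using sum0 by (simp add: pm.scale_sum_left act_monom)
    hence "coeff (\<Sum>i\<in>?I. monom (c i) i) i = 0" using none by (metis coeff_0)
    thus ?thesis using i by (simp add: coeff_sum)
  qed
  have inj: "inj_on (\<lambda>i. (u ^^ i) v) ?I"
    by (rule independent_image(1)) (simp, rule free)
  have "independent ((\<lambda>i. (u ^^ i) v) ` ?I)"
    by (rule independent_image(2)) (simp, rule free)
  hence "card ((\<lambda>i. (u ^^ i) v) ` ?I) \<le> card Basis"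
    using independent_span_bound[OF finite_Basis] span_Basis by auto
  thus False using card_image[OF inj] by simp
qed

text \<open>The product of annihilators of the individual basis vectors kills the whole
  basis.\<close>

lemma exists_annihilating_poly: "\<exists>f. f \<noteq> 0 \<and> annihilates scale f u"
proof -
  have "\<exists>f. \<forall>v. f v \<noteq> 0 \<and> act (f v) v = 0" using exists_annihilating_vector_poly by metis
  then obtain f where f: "\<And>v. f v \<noteq> 0" "\<And>v. act (f v) v = 0" by blast
  have "act (\<Prod>v\<in>Basis. f v) b = 0" if "b \<in> Basis" for b
  proof -
    have "(\<Prod>v\<in>Basis. f v) = (\<Prod>v\<in>Basis - {b}. f v) * f b"
      using that finite_Basis by (simp add: prod.remove mult.commute)
    thus ?thesis using act_mult[of _ "f b" b] f(2)[of b] by simp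
  qed
  hence "annihilates scale (\<Prod>v\<in>Basis. f v) u" using annihilatesI_span span_Basis by blast
  moreover have "(\<Prod>v\<in>Basis. f v) \<noteq> 0" using f(1) finite_Basis by simp
  ultimately show ?thesis by blast
qed

text \<open>The minimal polynomial is the monic generator of the annihilator, and a monic divisor of
  a power of \<open>P\<close> is again a power of \<open>P\<close>. The zero space is covered by
  exponent 0.\<close>

lemma is_minimal_poly_power_iff:
  assumes irr: "irreducible P" and monic: "lead_coeff P = 1"
  shows "(\<exists>k. is_minimal_poly scale u (P ^ k)) \<longleftrightarrow> (\<exists>k. annihilates scale (P ^ k) u)"
proof
  assume "\<exists>k. is_minimal_poly scale u (P ^ k)"
  thus "\<exists>k. annihilates scale (P ^ k) u" unfolding is_minimal_poly_def by (meson dvd_refl)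
next
  assume "\<exists>k. annihilates scale (P ^ k) u"
  then obtain k where k: "annihilates scale (P ^ k) u" by blast
  obtain m where m: "lead_coeff m = 1" "\<And>f. f \<in> {f. annihilates scale f u} \<longleftrightarrow> m dvd f"
  proof (rule poly_ideal_principal[of "{f. annihilates scale f u}"])
    show "P ^ k \<in> {f. annihilates scale f u}" "P ^ k \<noteq> 0" using k irr by auto
  qed (auto simp: annihilates_def act_add simp flip: pm.scale_scale)
  have "m dvd P ^ k" using m(2) k by blast
  then obtain j where "m = P ^ j" using monic_dvd_irreducible_power[OF irr monic m(1)] by blast
  thus "\<exists>k. is_minimal_poly scale u (P ^ k)" using m unfolding is_minimal_poly_def by auto
qed

text \<open>Instead of extending scalars, a left eigenvector of the matrix is read as an additive
  map \<open>l\<close> from the space to the closure with \<open>l (u v) = z * l v\<close>. Then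
  \<open>l (act f v)\<close> is the value of \<open>f\<close> at \<open>z\<close> times
  \<open>l v\<close>, and \<open>l\<close> is nonzero on some basis vector.\<close>

lemma eigenvalue_ac_root:
  assumes eig: "eigenvalue_ac scale u z" and ann: "annihilates scale f u"
  shows "poly (map_poly to_ac f) z = 0"
proof -
  obtain bs A where basis: "ordered_basis scale bs" and rep: "represented_by scale bs u A"
    and A_eig: "eigenvalue (map_mat to_ac A) z"
    using eig unfolding eigenvalue_ac_def by blast
  let ?n = "length bs" and ?M = "map_mat to_ac A"
  let ?R = "representation (set bs)"
  have A: "A \<in> carrier_mat ?n ?n" using rep by (simp add: represented_by_def)
  hence M: "?M \<in> carrier_mat ?n ?n" and MT: "transpose_mat ?M \<in> carrier_mat ?n ?n" by auto
  have dist: "distinct bs" and ind: "independent (set bs)" and spn: "span (set bs) = UNIV"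
    using basis by (auto simp: ordered_basis_def)
  \<comment> \<open>A matrix and its transpose have the same characteristic polynomial.\<close>
  have "eigenvalue (transpose_mat ?M) z"
    using A_eig unfolding eigenvalue_root_char_poly[OF M] eigenvalue_root_char_poly[OF MT]
      char_poly_transpose_mat[OF M] .
  then obtain w where w: "w \<in> carrier_vec ?n" "w \<noteq> 0\<^sub>v ?n" "transpose_mat ?M *\<^sub>v w = z \<cdot>\<^sub>v w"
    using A unfolding eigenvalue_def eigenvector_def by auto
  have w_eig: "(\<Sum>i<?n. w $ i * to_ac (A $$ (i, j))) = z * w $ j" if "j < ?n" for j
  proof -
    have "(transpose_mat ?M *\<^sub>v w) $ j = (\<Sum>i<?n. w $ i * to_ac (A $$ (i, j)))"
      using A w(1) that by (simp add: scalar_prod_def atLeast0LessThan mult.commute)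
    thus ?thesis using w that by simp
  qed
  define l where "l v = (\<Sum>i<?n. w $ i * to_ac (?R v (bs ! i)))" for v
  have l_add: "l (v + v') = l v + l v'" for v v'
    using ind spn by (simp add: l_def representation_add sum.distrib algebra_simps)
  have l_scale: "l (c *s v) = to_ac c * l v" for c v
    using ind spn by (simp add: l_def representation_scale sum_distrib_left algebra_simps)
  have l_0: "l 0 = 0" using l_scale[of 0 0] by simp
  have l_sum: "l (\<Sum>i\<in>I. h i) = (\<Sum>i\<in>I. l (h i))" for h :: "nat \<Rightarrow> 'v" and I
    by (induction I rule: infinite_finite_induct) (simp_all add: l_0 l_add)
  have l_basis: "l (bs ! j) = w $ j" if "j < ?n" for j
  proof -
    have "l (bs ! j) = (\<Sum>i<?n. if i = j then w $ i else 0)"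
      unfolding l_def using that dist
      by (intro sum.cong) (auto simp: representation_basis[OF ind] nth_eq_iff_index_eq)
    thus ?thesis using that by simp
  qed
  have l_u: "l (u v) = z * l v" for v
  proof -
    have "v \<in> span (set bs)" using spn by simp
    thus ?thesis
    proof (induction rule: span_induct_alt)
      case base
      show ?case by (simp add: l_0)
    next
      case (step c b v)
      then obtain j where j: "j < ?n" "b = bs ! j" by (auto simp: in_set_conv_nth)
      have "l (u b) = (\<Sum>i<?n. w $ i * to_ac (A $$ (i, j)))"
        using rep j by (simp add: represented_by_def l_sum l_scale l_basis mult.commute)
      hence "l (u b) = z * l b" using w_eig j l_basis by simp
      thus ?case using step by (simp add: u.add u.scale l_add l_scale algebra_simps)
    qed
  qed
  have l_act: "l (act g v) = poly (map_poly to_ac g) z * l v" for g v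
    by (induction g) (simp_all add: act_pCons l_add l_scale l_u l_0 algebra_simps)
  obtain j where "j < ?n" "w $ j \<noteq> 0" using w(1,2) by (metis carrier_vecD eq_vecI index_zero_vec(1,2))
  thus ?thesis using l_act[of f "bs ! j"] ann l_basis by (simp add: annihilates_def l_0)
qed

text \<open>The vectors \<open>w\<close>, \<open>u w\<close>, and so on below
  \<open>degree r\<close> are independent and span an invariant subspace. In a basis extending them
  the matrix is block triangular with the companion matrix of \<open>r\<close> in the corner, whose
  eigenvector is padded with zeros.\<close>

lemma eigenvalue_ac_of_annihilator_root:
  assumes monic: "lead_coeff r = 1" and deg: "0 < degree r"
    and ann: "\<And>f. act f w = 0 \<longleftrightarrow> r dvd f"
    and root: "poly (map_poly to_ac r) z = 0"
  shows "eigenvalue_ac scale u z"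
proof -
  let ?d = "degree r" and ?C = "companion_mat r"
  define ws where "ws = map (\<lambda>j. (u ^^ j) w) [0..<?d]"
  have len_ws: "length ws = ?d" by (simp add: ws_def)
  have free: "c i = 0" if sum0: "(\<Sum>i<?d. c i *s (u ^^ i) w) = 0" and i: "i \<in> {..<?d}" for c i
  proof -
    define f where "f = (\<Sum>i<?d. monom (c i) i)"
    have coeff_f: "coeff f k = (if k < ?d then c k else 0)" for k by (simp add: f_def coeff_sum)
    have "act f w = 0" using sum0 by (simp add: f_def pm.scale_sum_left act_monom)
    hence "r dvd f" using ann by blast
    have "f = 0"
    proof (rule ccontr)
      assume "f \<noteq> 0"
      hence "?d \<le> degree f" using \<open>r dvd f\<close> by (rule dvd_imp_degree_le[rotated])
      thus False using coeff_f[of "degree f"] \<open>f \<noteq> 0\<close> by simp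
    qed
    thus ?thesis using coeff_f[of i] i by simp
  qed
  have inj: "inj_on (\<lambda>i. (u ^^ i) w) {..<?d}"
    by (rule independent_image(1)) (simp, rule free)
  have "independent ((\<lambda>i. (u ^^ i) w) ` {..<?d})"
    by (rule independent_image(2)) (simp, rule free)
  moreover have "set ws = (\<lambda>i. (u ^^ i) w) ` {..<?d}" by (auto simp: ws_def)
  ultimately have ind: "independent (set ws)" by simp
  have dist: "distinct ws" using inj by (simp add: ws_def distinct_map atLeast0LessThan)
  let ?E = "extend_basis (set ws)"
  note E = extend_basis_superset[OF ind] independent_extend_basis[OF ind] span_extend_basis[OF ind]
  have finE: "finite ?E" using independent_span_bound[OF finite_Basis E(2)] span_Basis by simp
  then obtain cs where cs: "set cs = ?E - set ws" "distinct cs"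
    using finite_distinct_list[of "?E - set ws"] by blast
  define bs where "bs = ws @ cs"
  let ?n = "length bs"
  have set_bs: "set bs = ?E" using cs E(1) by (auto simp: bs_def)
  have dist_bs: "distinct bs" using cs dist by (auto simp: bs_def)
  have basis: "ordered_basis scale bs" using dist_bs E set_bs by (simp add: ordered_basis_def)
  have dn: "?d \<le> ?n" by (simp add: bs_def len_ws)
  define A where "A = mat ?n ?n (\<lambda>(i, j).
    if j < ?d then (if i < ?d then ?C $$ (i, j) else 0) else representation ?E (u (bs ! j)) (bs ! i))"
  have C: "represented_by scale ws u ?C"
    unfolding represented_by_companion_mat[OF monic deg] ws_def by (intro exI[of _ w]) (simp add: ann)
  have "u (bs ! j) = (\<Sum>i<?n. A $$ (i, j) *s bs ! i)" if j: "j < ?n" for j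
  proof (cases "j < ?d")
    case True
    have "(\<Sum>i<?n. A $$ (i, j) *s bs ! i) = (\<Sum>i<?d. ?C $$ (i, j) *s ws ! i)"
      using True j dn len_ws
      by (intro sum.mono_neutral_cong_right) (auto simp: A_def bs_def nth_append)
    also have "\<dots> = u (ws ! j)" using C True len_ws by (simp add: represented_by_def)
    finally show ?thesis using True len_ws by (simp add: bs_def nth_append)
  next
    case False
    have "(\<Sum>i<?n. A $$ (i, j) *s bs ! i) = (\<Sum>i<?n. representation ?E (u (bs ! j)) (bs ! i) *s bs ! i)"
      using j False by (simp add: A_def)
    also have "\<dots> = (\<Sum>b\<in>set bs. representation ?E (u (bs ! j)) b *s b)"
      by (rule sum.reindex_bij_betw) (use bij_betw_nth[OF dist_bs] in auto)
    also have "\<dots> = u (bs ! j)"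
      unfolding set_bs by (rule sum_representation_eq) (use E finE in auto)
    finally show ?thesis by simp
  qed
  hence rep: "represented_by scale bs u A" by (simp add: represented_by_def A_def)
  obtain g where g: "map_poly to_ac r = [:- z, 1:] * g" using root unfolding poly_eq_0_iff_dvd by blast
  define ev where "ev = vec ?n (\<lambda>i. if i < ?d then coeff g i else 0)"
  have "g \<noteq> 0" using g monic by auto
  moreover have "degree (map_poly to_ac r) = ?d" by simp
  ultimately have "?d = Suc (degree g)" unfolding g by (subst (asm) degree_mult_eq) auto
  hence "ev $ degree g \<noteq> 0" "degree g < ?n" using dn \<open>g \<noteq> 0\<close> by (auto simp: ev_def)
  hence ev_nz: "ev \<noteq> 0\<^sub>v ?n" by auto
  have "map_mat to_ac A *\<^sub>v ev = z \<cdot>\<^sub>v ev"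
  proof (rule eq_vecI)
    fix i assume "i < dim_vec (z \<cdot>\<^sub>v ev)"
    hence i: "i < ?n" by (simp add: ev_def)
    have "(map_mat to_ac A *\<^sub>v ev) $ i = (\<Sum>j<?n. to_ac (A $$ (i, j)) * ev $ j)"
      using i by (simp add: A_def ev_def scalar_prod_def atLeast0LessThan)
    also have "\<dots> = (\<Sum>j<?d. to_ac (if i < ?d then ?C $$ (i, j) else 0) * coeff g j)"
      using dn i by (intro sum.mono_neutral_cong_right) (auto simp: A_def ev_def)
    also have "\<dots> = z * ev $ i"
      using companion_mat_eigenvector[OF monic g, of i] i by (auto simp: ev_def)
    finally show "(map_mat to_ac A *\<^sub>v ev) $ i = (z \<cdot>\<^sub>v ev) $ i" using i by (simp add: ev_def)
  qed (simp add: A_def ev_def)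
  moreover have "ev \<in> carrier_vec ?n" "dim_row (map_mat to_ac A) = ?n"
    by (simp_all add: ev_def A_def)
  ultimately have "eigenvalue (map_mat to_ac A) z"
    unfolding eigenvalue_def eigenvector_def using ev_nz by metis
  thus ?thesis unfolding eigenvalue_ac_def using basis rep by blast
qed

text \<open>For the converse, write an annihilating polynomial as \<open>P ^ k * g\<close> with
  \<open>P\<close> not dividing \<open>g\<close>. A nonzero value of \<open>P ^ k\<close> is killed
  by \<open>g\<close>, so a root of its annihilator is an eigenvalue that is a root of
  \<open>g\<close>. By hypothesis it is a root of \<open>P\<close> as well, against
  coprimality.\<close>

lemma annihilates_power_iff_eigenvalues:
  assumes irr: "irreducible P"
  shows "(\<exists>k. annihilates scale (P ^ k) u) \<longleftrightarrow>
    (\<forall>z. eigenvalue_ac scale u z \<longrightarrow> poly (map_poly to_ac P) z = 0)"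
proof
  assume "\<exists>k. annihilates scale (P ^ k) u"
  thus "\<forall>z. eigenvalue_ac scale u z \<longrightarrow> poly (map_poly to_ac P) z = 0"
    using eigenvalue_ac_root by (metis ac.hom_power poly_power power_not_zero)
next
  assume eig: "\<forall>z. eigenvalue_ac scale u z \<longrightarrow> poly (map_poly to_ac P) z = 0"
  obtain f where f: "f \<noteq> 0" "annihilates scale f u" using exists_annihilating_poly by blast
  \<comment> \<open>The multiplicity of \<open>P\<close> in \<open>f\<close>; the degree bounds the
    exponents, so it exists.\<close>
  define k where "k = (LEAST i. \<not> P ^ Suc i dvd f)"
  have P: "P \<noteq> 0" "0 < degree P" using irr by (auto simp: irreducible_def is_unit_iff_degree)
  have "\<not> P ^ Suc (degree f) dvd f"
  proof
    assume "P ^ Suc (degree f) dvd f"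
    hence "degree (P ^ Suc (degree f)) \<le> degree f" using f(1) by (rule dvd_imp_degree_le)
    hence "degree P * Suc (degree f) \<le> degree f" unfolding degree_power_eq[OF P(1)] .
    moreover have "1 * Suc (degree f) \<le> degree P * Suc (degree f)" using P(2) by (intro mult_le_mono1) simp
    ultimately show False by (metis mult_1 order_trans Suc_n_not_le_n)
  qed
  hence k: "\<not> P ^ Suc k dvd f" unfolding k_def by (rule LeastI)
  have "P ^ k dvd f"
  proof (cases k)
    case (Suc i)
    thus ?thesis using not_less_Least[of i "\<lambda>i. \<not> P ^ Suc i dvd f"] by (simp add: k_def)
  qed simp
  then obtain g where g: "f = P ^ k * g" by (rule dvdE)
  have ndvd: "\<not> P dvd g"
  proof
    assume "P dvd g"
    hence "P ^ k * P dvd P ^ k * g" by (rule mult_dvd_mono[OF dvd_refl])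
    thus False using k by (simp add: g mult.commute)
  qed
  have "act (P ^ k) v = 0" for v
  proof (rule ccontr)
    assume w: "act (P ^ k) v \<noteq> 0"
    let ?w = "act (P ^ k) v"
    have gw: "act g ?w = 0" using f(2) by (simp add: annihilates_def g mult.commute)
    have "g \<noteq> 0" using g f(1) by auto
    obtain r where r: "lead_coeff r = 1" "\<And>h. h \<in> {h. act h ?w = 0} \<longleftrightarrow> r dvd h"
    proof (rule poly_ideal_principal[of "{h. act h ?w = 0}"])
      show "g \<in> {h. act h ?w = 0}" using gw by simp
      show "h + h' \<in> {h. act h ?w = 0}" if "h \<in> {h. act h ?w = 0}" "h' \<in> {h. act h ?w = 0}" for h h'
        using that by (simp only: mem_Collect_eq act_add) simp
      show "h * h' \<in> {h. act h ?w = 0}" if "h' \<in> {h. act h ?w = 0}" for h h'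
        using that by (simp only: mem_Collect_eq act_mult pm.scale_zero_right)
    qed (use \<open>g \<noteq> 0\<close> in auto)
    have "0 < degree r"
    proof (rule ccontr)
      assume "\<not> 0 < degree r"
      hence "r dvd 1" using r(1) by (auto simp: is_unit_iff_degree)
      thus False using r(2)[of 1] w by simp
    qed
    moreover from this have "0 < degree (map_poly to_ac r)" by simp
    then obtain z where z: "poly (map_poly to_ac r) z = 0" using alg_closed_imp_poly_has_root by blast
    ultimately have "eigenvalue_ac scale u z"
      using r by (intro eigenvalue_ac_of_annihilator_root[of r ?w]) auto
    hence Pz: "poly (map_poly to_ac P) z = 0" using eig by blast
    have "r dvd g" using r(2)[of g] gw by simp
    then obtain g' where "g = r * g'" by (rule dvdE)
    hence gz: "poly (map_poly to_ac g) z = 0" using z by (simp add: ac.hom_mult)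
    obtain a b where "a * g + b * P = 1" using bezout_irreducible[OF irr ndvd] by blast
    hence "poly (map_poly to_ac (a * g + b * P)) z = 1" by simp
    thus False using Pz gz by (simp add: ac.hom_add ac.hom_mult)
  qed
  thus "\<exists>k. annihilates scale (P ^ k) u" unfolding annihilates_def by blast
qed

text \<open>Forwards, the generators of the cyclic decomposition provide the blocks. Backwards, the
  largest exponent kills the first vector of every block and hence its orbit.\<close>

lemma annihilates_power_iff_companion_form:
  fixes P :: "'a poly"
  assumes irr: "irreducible P" and monic: "lead_coeff P = 1"
  shows "(\<exists>k. annihilates scale (P ^ k) u) \<longleftrightarrow>
    (\<exists>bs ns. ordered_basis scale bs \<and> (\<forall>n\<in>set ns. 0 < n) \<and>
       represented_by scale bs u (diag_block_mat (map (\<lambda>n. companion_mat (P ^ n)) ns)))"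
proof
  have P: "P \<noteq> 0" "0 < degree P" using irr by (auto simp: irreducible_def is_unit_iff_degree)
  have rs: "lead_coeff r = 1 \<and> 0 < degree r" if ns: "\<forall>n\<in>set ns. 0 < n" and r: "r \<in> set (map (\<lambda>n. P ^ n) ns)" for r ns
  proof -
    obtain n where "0 < n" "r = P ^ n" using ns r by auto
    thus ?thesis using P(2) degree_power_eq[OF P(1), of n] monic_power[OF monic, of n] by auto
  qed
  {
    assume "\<exists>k. annihilates scale (P ^ k) u"
    then obtain k where k: "annihilates scale (P ^ k) u" by blast
    obtain S n where S: "finite S" "pm.span S = UNIV"
      "\<forall>v\<in>S. 0 < n v \<and> act (P ^ n v) v = 0"
      "\<forall>f. (\<Sum>v\<in>S. act (f v) v) = 0 \<longrightarrow> (\<forall>v\<in>S. P ^ n v dvd f v)"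
      by (rule cyclic_decomposition[OF irr k])
    obtain vs where vs: "set vs = S" "distinct vs" using finite_distinct_list[OF S(1)] by blast
    let ?bs = "concat (map (\<lambda>v. map (\<lambda>j. (u ^^ j) v) [0..<degree (P ^ n v)]) vs)"
    have "ordered_basis scale ?bs"
      by (rule ordered_basis_cyclic) (use S vs P in auto)
    moreover have pos: "\<forall>m\<in>set (map n vs). 0 < m" using S(3) vs by simp
    moreover have "represented_by scale ?bs u (diag_block_mat (map (\<lambda>n. companion_mat (P ^ n)) (map n vs)))"
    proof -
      have all2: "list_all2 (\<lambda>r v. act r v = 0) (map (\<lambda>n. P ^ n) (map n vs)) vs"
        using S(3) vs by (auto simp: list_all2_map1 list_all2_same)
      have map2_eq: "map2 (\<lambda>r v. map (\<lambda>j. (u ^^ j) v) [0..<degree r]) (map (\<lambda>n. P ^ n) (map n vs)) vs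
        = map (\<lambda>v. map (\<lambda>j. (u ^^ j) v) [0..<degree (P ^ n v)]) vs"
        by (induction vs) auto
      have rep_iff: "represented_by scale ?bs u (diag_block_mat (map companion_mat (map (\<lambda>n. P ^ n) (map n vs)))) \<longleftrightarrow>
          (\<exists>ws. list_all2 (\<lambda>r v. act r v = 0) (map (\<lambda>n. P ^ n) (map n vs)) ws \<and>
            ?bs = concat (map2 (\<lambda>r v. map (\<lambda>j. (u ^^ j) v) [0..<degree r]) (map (\<lambda>n. P ^ n) (map n vs)) ws))"
        by (rule represented_by_diag_companion_mat) (rule rs[OF pos])
      have "represented_by scale ?bs u (diag_block_mat (map companion_mat (map (\<lambda>n. P ^ n) (map n vs))))"
        unfolding rep_iff by (intro exI[of _ vs] conjI all2) (simp only: map2_eq)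
      thus ?thesis by (simp add: o_def)
    qed
    ultimately show "\<exists>bs ns. ordered_basis scale bs \<and> (\<forall>n\<in>set ns. 0 < n) \<and>
       represented_by scale bs u (diag_block_mat (map (\<lambda>n. companion_mat (P ^ n)) ns))" by blast
  next
    assume "\<exists>bs ns. ordered_basis scale bs \<and> (\<forall>n\<in>set ns. 0 < n) \<and>
       represented_by scale bs u (diag_block_mat (map (\<lambda>n. companion_mat (P ^ n)) ns))"
    then obtain bs ns where basis: "ordered_basis scale bs" and ns: "\<forall>n\<in>set ns. 0 < n"
      and rep: "represented_by scale bs u (diag_block_mat (map companion_mat (map (\<lambda>n. P ^ n) ns)))"
      by (auto simp: o_def)
    have "represented_by scale bs u (diag_block_mat (map companion_mat (map (\<lambda>n. P ^ n) ns))) \<longleftrightarrow>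
        (\<exists>vs. list_all2 (\<lambda>r v. act r v = 0) (map (\<lambda>n. P ^ n) ns) vs \<and>
          bs = concat (map2 (\<lambda>r v. map (\<lambda>j. (u ^^ j) v) [0..<degree r]) (map (\<lambda>n. P ^ n) ns) vs))"
      by (rule represented_by_diag_companion_mat) (rule rs[OF ns])
    with rep obtain vs where vs: "list_all2 (\<lambda>r v. act r v = 0) (map (\<lambda>n. P ^ n) ns) vs"
      "bs = concat (map2 (\<lambda>r v. map (\<lambda>j. (u ^^ j) v) [0..<degree r]) (map (\<lambda>n. P ^ n) ns) vs)"
      by blast
    \<comment> \<open>If \<open>ns\<close> is empty, \<open>Max\<close> is unspecified, but then
      \<open>bs\<close> is empty and nothing has to be checked on it.\<close>
    have "annihilates scale (P ^ Max (set ns)) u"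
    proof (rule annihilatesI_span)
      show "span (set bs) = UNIV" using basis by (simp add: ordered_basis_def)
      fix b assume "b \<in> set bs"
      then obtain r v j where rv: "(r, v) \<in> set (zip (map (\<lambda>n. P ^ n) ns) vs)" "b = (u ^^ j) v"
        unfolding vs(2) by auto
      have "r \<in> set (map (\<lambda>n. P ^ n) ns)" using rv(1) by (rule set_zip_leftD)
      then obtain n where n: "n \<in> set ns" "r = P ^ n" by auto
      have "act r v = 0" using vs(1) rv(1) unfolding list_all2_iff by auto
      moreover have "P ^ n dvd P ^ Max (set ns)" using n(1) by (intro le_imp_power_dvd) simp
      then obtain h where "P ^ Max (set ns) = h * P ^ n" by (metis dvd_def mult.commute)
      ultimately have "act (P ^ Max (set ns)) v = 0" using n(2) act_mult[of h "P ^ n" v] by simp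
      moreover have "b = act (monom 1 j) v" by (simp add: act_monom rv(2))
      ultimately show "act (P ^ Max (set ns)) b = 0"
        using act_commute[of "P ^ Max (set ns)" "monom 1 j" v] by (metis pm.scale_zero_right)
    qed
    thus "\<exists>k. annihilates scale (P ^ k) u" by blast
  }
qed

end

section \<open>Building the difference\<close>

text \<open>The divided difference \<open>(f(t) - f(- c - t)) / (t - (- c - t))\<close>, described so that it also
  makes sense in characteristic 2. It is linear over the polynomials in \<open>t\<^sup>2 + c t\<close>, which are
  invariant under \<open>t \<mapsto> - c - t\<close>.\<close>
primrec divdiff_power :: "'a::field \<Rightarrow> nat \<Rightarrow> 'a poly" where
  "divdiff_power c 0 = 0"
| "divdiff_power c (Suc i) = monom 1 i + [:- c, - 1:] * divdiff_power c i"

definition divdiff :: "'a::field \<Rightarrow> 'a poly \<Rightarrow> 'a poly" where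
  "divdiff c f = (\<Sum>i\<le>degree f. smult (coeff f i) (divdiff_power c i))"

lemma divdiff_0 [simp]: "divdiff c 0 = 0"
  by (simp add: divdiff_def)

text \<open>A twisted Leibniz rule for multiplication by \<open>t\<close>: the factor
  \<open>[:- c, - 1:]\<close> is the conjugate \<open>- c - t\<close> of \<open>t\<close>. The later
  inductions on polynomials rest on it.\<close>

lemma divdiff_pCons: "divdiff c (pCons a f) = f + [:- c, - 1:] * divdiff c f"
proof -
  have "divdiff c (pCons a f) = (\<Sum>i\<le>Suc (degree f). smult (coeff (pCons a f) i) (divdiff_power c i))"
    unfolding divdiff_def by (intro sum.mono_neutral_left) (auto simp: degree_pCons_le coeff_eq_0)
  also have "\<dots> = (\<Sum>i\<le>degree f. smult (coeff f i) (monom 1 i + [:- c, - 1:] * divdiff_power c i))"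
    by (subst sum.atMost_Suc_shift) simp
  also have "\<dots> = (\<Sum>i\<le>degree f. monom (coeff f i) i) + [:- c, - 1:] * divdiff c f"
    unfolding divdiff_def sum_distrib_left sum.distrib[symmetric]
    by (intro sum.cong) (simp_all add: smult_add_right smult_monom del: mult_pCons_left)
  finally show ?thesis by (simp only: poly_as_sum_of_monoms)
qed

lemma divdiff_add: "divdiff c (f + g) = divdiff c f + divdiff c g"
proof (induction f g rule: poly_induct2)
  case (pCons a f b g)
  thus ?case unfolding add_pCons divdiff_pCons by (simp only: ring_distribs add_ac)
qed simp

lemma divdiff_smult: "divdiff c (smult a f) = smult a (divdiff c f)"
proof (induction f)
  case (pCons b f)
  thus ?case unfolding smult_pCons divdiff_pCons by (simp only: smult_add_right mult_smult_right)
qed simp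

lemma quadratic_poly_eq: "[:d, c, 1:] = [:d:] + [:c:] * [:0, 1:] + [:0, 1:] * [:0, 1 :: 'a::comm_ring_1:]"
  by simp

lemma conjugate_poly_eq: "[:- c, - 1:] = - [:c:] - [:0, 1 :: 'a::comm_ring_1:]"
  by simp

lemma divdiff_X_mult: "divdiff c ([:0, 1:] * f) = f + (- [:c:] - [:0, 1:]) * divdiff c f"
  using divdiff_pCons[of c 0 f] unfolding conjugate_poly_eq by simp

lemma divdiff_const_mult: "divdiff c ([:a:] * f) = [:a:] * divdiff c f"
  using divdiff_smult[of c a f] by simp

lemma divdiff_uminus: "divdiff c (- f) = - divdiff c f"
  using divdiff_smult[of c "- 1" f] by simp

lemma divdiff_diff: "divdiff c (f - g) = divdiff c f - divdiff c g"
  using divdiff_add[of c f "- g"] by (simp add: divdiff_uminus)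

lemma divdiff_quadratic_mult:
  fixes c :: "'a::field"
  shows "divdiff c ([:d, c, 1:] * f) = [:d, c, 1:] * divdiff c f"
proof -
  define t :: "'a poly" where "t = [:0, 1:]"
  have t_mult: "divdiff c (t * f) = f + (- [:c:] - t) * divdiff c f" for f
    unfolding t_def by (rule divdiff_X_mult)
  \<comment> \<open>The outcome of applying the rule for \<open>t\<close> once and twice, with
    \<open>g\<close> for \<open>f\<close> and \<open>h\<close> for \<open>divdiff c f\<close>: the
    contributions of \<open>g\<close> cancel, and those of \<open>h\<close> reassemble to the
    quadratic.\<close>
  have ring: "D * h + C * (g + (- C - t) * h) + (t * g + (- C - t) * (g + (- C - t) * h))
      = D * h + C * (t * h) + t * (t * h)" for C D g h :: "'a poly"
    by (simp add: algebra_simps)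
  have "divdiff c (([:d:] + [:c:] * t + t * t) * f) = ([:d:] + [:c:] * t + t * t) * divdiff c f"
    unfolding distrib_right mult.assoc divdiff_add divdiff_const_mult
      t_mult
    by (rule ring)
  thus ?thesis unfolding quadratic_poly_eq[of d c] t_def .
qed

text \<open>After one application to \<open>a + t * f\<close>, the second yields
  \<open>divdiff c f\<close> once from \<open>f\<close> and once, with opposite sign, from
  \<open>t * divdiff c f\<close>. All other terms contain the double application to
  \<open>f\<close>.\<close>

lemma divdiff_divdiff:
  fixes c :: "'a::field"
  shows "divdiff c (divdiff c f) = 0"
proof (induction f)
  case (pCons a f)
  define t :: "'a poly" where "t = [:0, 1:]"
  have t_mult: "divdiff c (t * f) = f + (- [:c:] - t) * divdiff c f" for f
    unfolding t_def by (rule divdiff_X_mult)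
  have "divdiff c (divdiff c (pCons a f)) = divdiff c (f + (- [:c:] - t) * divdiff c f)"
    unfolding divdiff_pCons conjugate_poly_eq t_def ..
  also have "\<dots> = divdiff c f - [:c:] * divdiff c (divdiff c f) - divdiff c (t * divdiff c f)"
    unfolding left_diff_distrib mult_minus_left divdiff_add divdiff_diff divdiff_uminus divdiff_const_mult
    by simp
  also have "\<dots> = 0" unfolding t_mult pCons.IH by simp
  finally show ?case .
qed simp

section \<open>Carrying operators on polynomials over to the space\<close>

context endo_space begin

text \<open>As \<open>N\<close> preserves the ideals generated by powers of \<open>P\<close>, it
  descends to every cyclic summand, and its identities descend with it. For \<open>P\<close> equal
  to \<open>[:d, c, 1:]\<close>, assumption \<open>NX\<close> is the expansion of
  \<open>(t + N)^2 + c (t + N) + d = 0\<close>.\<close>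

lemma lift_poly_operator:
  fixes P :: "'a poly"
  assumes irr: "irreducible P" and ann: "annihilates scale (P ^ k) u"
    and N_add: "\<And>f g. N (f + g) = N f + N g" and N_smult: "\<And>c f. N (smult c f) = smult c (N f)"
    and N_dvd: "\<And>m f. P ^ m dvd f \<Longrightarrow> P ^ m dvd N f"
    and NN: "\<And>f. N (N f) = smult e (N f)"
    and NX: "\<And>f. N ([:0, 1:] * f) + [:0, 1:] * N f + N (N f) + smult c (N f) + P * f = 0"
  obtains n where "Vector_Spaces.linear scale scale n" "\<forall>v. n (n v) = e *s n v"
    "\<forall>v. n (u v) + u (n v) + n (n v) + c *s n v + act P v = 0"
proof -
  obtain S m where S: "finite S" "pm.span S = UNIV" "\<forall>v\<in>S. 0 < m v \<and> act (P ^ m v) v = 0"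
    "\<forall>f. (\<Sum>v\<in>S. act (f v) v) = 0 \<longrightarrow> (\<forall>v\<in>S. P ^ m v dvd f v)"
    by (rule cyclic_decomposition[OF irr ann])
  \<comment> \<open>The surjection from families of polynomials indexed by \<open>S\<close> onto the
    space; \<open>\<psi>\<close> below merely chooses preimages.\<close>
  define \<phi> where "\<phi> f = (\<Sum>v\<in>S. act (f v) v)" for f
  have \<phi>_add: "\<phi> (\<lambda>v. f v + g v) = \<phi> f + \<phi> g" for f g
    by (simp add: \<phi>_def act_add sum.distrib)
  have \<phi>_smult: "\<phi> (\<lambda>v. smult a (f v)) = a *s \<phi> f" for a f
    by (simp add: \<phi>_def act_smult scale_sum_right)
  have \<phi>_mult: "\<phi> (\<lambda>v. g * f v) = act g (\<phi> f)" for g f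
    unfolding \<phi>_def act_mult pm.scale_sum_right ..
  have "\<exists>f. \<phi> f = v" for v
  proof -
    have "v \<in> pm.span S" using S(2) by simp
    thus ?thesis unfolding pm.span_finite[OF S(1)] \<phi>_def by auto
  qed
  then obtain \<psi> where \<psi>: "\<And>v. \<phi> (\<psi> v) = v" by metis
  define n where "n v = \<phi> (\<lambda>x. N (\<psi> v x))" for v
  \<comment> \<open>Independence of the chosen preimage: two preimages of a vector differ at
    \<open>x\<close> by a multiple of \<open>P ^ m x\<close>, and \<open>N\<close> maps it to such a
    multiple, which kills \<open>x\<close>.\<close>
  have n\<phi>: "n (\<phi> f) = \<phi> (\<lambda>x. N (f x))" for f
  proof -
    define g where "g = \<psi> (\<phi> f)"
    have g: "\<phi> g = \<phi> f" by (simp add: g_def \<psi>)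
    define h where "h x = g x + smult (- 1) (f x)" for x
    have "\<phi> h = 0" using g unfolding h_def \<phi>_add \<phi>_smult by simp
    hence h: "P ^ m x dvd h x" if "x \<in> S" for x using S(4) that unfolding \<phi>_def by blast
    have "act (N (h x)) x = 0" if x: "x \<in> S" for x
    proof -
      obtain k where "N (h x) = k * P ^ m x" using N_dvd[OF h[OF x]] by (metis dvd_def mult.commute)
      thus ?thesis using act_mult[of k "P ^ m x" x] S(3) x by simp
    qed
    hence "\<phi> (\<lambda>x. N (h x)) = 0" by (simp add: \<phi>_def)
    thus ?thesis unfolding h_def N_add N_smult \<phi>_add \<phi>_smult n_def g_def[symmetric] by simp
  qed
  show ?thesis
  proof (rule that)
    have n_add: "n (v + w) = n v + n w" for v w
    proof -
      have "\<phi> (\<lambda>x. \<psi> v x + \<psi> w x) = v + w" by (simp only: \<phi>_add \<psi>)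
      hence "n (v + w) = \<phi> (\<lambda>x. N (\<psi> v x + \<psi> w x))"
        using n\<phi>[of "\<lambda>x. \<psi> v x + \<psi> w x"] by (simp only:)
      thus ?thesis unfolding N_add \<phi>_add n_def[symmetric] .
    qed
    have n_scale: "n (a *s v) = a *s n v" for a v
    proof -
      have "\<phi> (\<lambda>x. smult a (\<psi> v x)) = a *s v" by (simp only: \<phi>_smult \<psi>)
      hence "n (a *s v) = \<phi> (\<lambda>x. N (smult a (\<psi> v x)))"
        using n\<phi>[of "\<lambda>x. smult a (\<psi> v x)"] by (simp only:)
      thus ?thesis unfolding N_smult \<phi>_smult n_def[symmetric] .
    qed
    show "Vector_Spaces.linear scale scale n"
      using n_add n_scale by (simp add: Vector_Spaces.linear_iff vector_space_axioms)
    show "\<forall>v. n (n v) = e *s n v"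
    proof
      fix v
      have "n (n (\<phi> (\<psi> v))) = e *s n (\<phi> (\<psi> v))" unfolding n\<phi> NN \<phi>_smult ..
      thus "n (n v) = e *s n v" unfolding \<psi> .
    qed
    have u\<phi>: "u (\<phi> g) = \<phi> (\<lambda>x. [:0, 1:] * g x)" for g unfolding \<phi>_mult act_X ..
    show "\<forall>v. n (u v) + u (n v) + n (n v) + c *s n v + act P v = 0"
    proof
      fix v
      define f where "f = \<psi> v"
      have v: "v = \<phi> f" by (simp add: f_def \<psi>)
      have "n (u v) + u (n v) + n (n v) + c *s n v + act P v =
        \<phi> (\<lambda>x. N ([:0, 1:] * f x) + [:0, 1:] * N (f x) + N (N (f x)) + smult c (N (f x)) + P * f x)"
        unfolding v u\<phi> n\<phi> \<phi>_add \<phi>_smult \<phi>_mult[of P] ..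
      also have "\<dots> = 0" unfolding NX by (simp add: \<phi>_def)
      finally show "n (u v) + u (n v) + n (n v) + c *s n v + act P v = 0" .
    qed
  qed
qed

lemma poly_endo_quadratic: "poly_endo scale [:d, c, 1:] h v = d *s v + c *s h v + h (h v)"
  by (simp add: poly_endo_def numeral_2_eq_2)

text \<open>The two polynomials are \<open>P(t - y)\<close>, for \<open>P\<close> with coefficients
  \<open>d\<close>, \<open>c\<close>, 1, and \<open>(t - y) * (t - y - e)\<close>. With
  \<open>b = y + n\<close> and \<open>a = u + b\<close> they evaluate to \<open>P(u + n)\<close> and
  \<open>n^2 - e n\<close>, which vanish by \<open>nu\<close> and \<open>nn\<close>.\<close>

lemma pq_difference_of_operator:
  assumes n: "Vector_Spaces.linear scale scale n" and nn: "\<forall>v. n (n v) = e *s n v"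
    and nu: "\<forall>v. n (u v) + u (n v) + n (n v) + c *s n v + act [:d, c, 1:] v = 0"
  shows "pq_difference scale [:d - c * y + y\<^sup>2, c - (y + y), 1:] [:y\<^sup>2 + e * y, - (y + y) - e, 1:] u"
proof -
  interpret n: Vector_Spaces.linear scale scale n by fact
  define b where "b v = y *s v + n v" for v
  define a where "a v = u v + b v" for v
  have "Vector_Spaces.linear scale scale b"
    by (simp add: Vector_Spaces.linear_iff vector_space_axioms b_def n.add n.scale algebra_simps)
  moreover have "Vector_Spaces.linear scale scale a"
    by (simp add: Vector_Spaces.linear_iff vector_space_axioms a_def b_def n.add n.scale u.add u.scale algebra_simps)
  moreover have "annihilates scale [:y\<^sup>2 + e * y, - (y + y) - e, 1:] b"
    unfolding annihilates_def poly_endo_quadratic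
  proof
    fix v
    have coeff: "(- (y + y) - e) *s w = - (y *s w + y *s w) - e *s w" for w
      by (simp only: scale_left_diff_distrib scale_minus_left scale_left_distrib)
    show "(y\<^sup>2 + e * y) *s v + (- (y + y) - e) *s b v + b (b v) = 0"
      unfolding coeff
      by (simp add: b_def n.add n.scale nn algebra_simps power2_eq_square)
  qed
  moreover have "annihilates scale [:d - c * y + y\<^sup>2, c - (y + y), 1:] a"
    unfolding annihilates_def poly_endo_quadratic
  proof
    fix v
    have nu': "n (u v) = - (u (n v) + n (n v) + c *s n v + (d *s v + c *s u v + u (u v)))"
      using spec[OF nu, of v] unfolding poly_endo_quadratic eq_neg_iff_add_eq_0 by (simp only: add.assoc)
    have coeff: "(c - (y + y)) *s w = c *s w - (y *s w + y *s w)" for w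
      by (simp only: scale_left_diff_distrib scale_left_distrib)
    show "(d - c * y + y\<^sup>2) *s v + (c - (y + y)) *s a v + a (a v) = 0"
      unfolding coeff
      by (simp add: a_def b_def n.add n.scale u.add u.scale nu' algebra_simps power2_eq_square)
  qed
  ultimately show ?thesis unfolding pq_difference_def by (intro exI[of _ a] exI[of _ b]) (simp add: a_def)
qed

end

section \<open>Properties of the two operators\<close>

text \<open>The coefficients of a second derivative carry a product of two consecutive integers,
  which is even.\<close>

lemma pderiv_pderiv_char_2:
  fixes f :: "'a::field poly"
  assumes "(2 :: 'a) = 0"
  shows "pderiv (pderiv f) = 0"
proof (rule poly_eqI)
  fix n
  obtain k where k: "Suc n * Suc (Suc n) = 2 * k" using evenE[of "Suc n * Suc (Suc n)"] by auto
  have "coeff (pderiv (pderiv f)) n = of_nat (Suc n * Suc (Suc n)) * coeff f (Suc (Suc n))"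
    by (simp only: coeff_pderiv of_nat_mult mult.assoc)
  also have "(of_nat (Suc n * Suc (Suc n)) :: 'a) = 2 * of_nat k" unfolding k by simp
  finally show "coeff (pderiv (pderiv f)) n = coeff 0 n" using assms by simp
qed

text \<open>Differentiation lowers the multiplicity of \<open>P\<close> by at most one, and the
  factor \<open>P\<close> restores it.\<close>

lemma power_dvd_mult_pderiv:
  fixes P f :: "'a::field poly"
  assumes "P ^ m dvd f"
  shows "P ^ m dvd P * pderiv f"
proof (cases m)
  case (Suc i)
  obtain h where f: "f = P ^ Suc i * h" using assms Suc by blast
  have "P * pderiv f = P ^ Suc i * (P * pderiv h + smult (of_nat (Suc i)) (h * pderiv P))"
    unfolding f pderiv_mult pderiv_power_Suc by (simp add: algebra_simps)
  thus ?thesis unfolding Suc by (metis dvd_triv_left)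
qed simp

lemma divdiff_quadratic_power_mult:
  "divdiff c ([:d, c, 1:] ^ m * f) = [:d, c, 1:] ^ m * divdiff c f"
  by (induction m) (simp_all only: power_0 mult_1 power_Suc mult.assoc divdiff_quadratic_mult)

context endo_space begin

lemma pq_difference_of_annihilated:
  fixes c d e y :: 'a
  defines "P \<equiv> [:d, c, 1:]"
  assumes irr: "irreducible P" and ann: "annihilates scale (P ^ k) u"
    and e: "e = 0 \<or> (2 :: 'a) = 0 \<and> e = c"
  shows "pq_difference scale [:d - c * y + y\<^sup>2, c - (y + y), 1:] [:y\<^sup>2 + e * y, - (y + y) - e, 1:] u"
  using e
proof
  assume "e = 0"
  define N where "N f = - (P * divdiff c f)" for f
  define t :: "'a poly" where "t = [:0, 1:]"
  have NN: "N (N f) = 0" for f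
  proof -
    have "N (N f) = P * divdiff c (P * divdiff c f)" by (simp add: N_def divdiff_uminus)
    thus ?thesis unfolding P_def divdiff_quadratic_mult divdiff_divdiff by simp
  qed
  obtain n where "Vector_Spaces.linear scale scale n" "\<forall>v. n (n v) = e *s n v"
    "\<forall>v. n (u v) + u (n v) + n (n v) + c *s n v + act P v = 0"
  proof (rule lift_poly_operator[OF irr ann, of N e c])
    show "N (f + g) = N f + N g" for f g by (simp add: N_def divdiff_add algebra_simps)
    show "N (smult a f) = smult a (N f)" for a f by (simp add: N_def divdiff_smult)
    show "P ^ m dvd N f" if "P ^ m dvd f" for m f
    proof -
      obtain h where h: "f = P ^ m * h" using \<open>P ^ m dvd f\<close> by (rule dvdE)
      have "N f = P ^ m * (- (P * divdiff c h))"
        unfolding h N_def P_def divdiff_quadratic_power_mult by (simp only: mult_minus_right mult.left_commute)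
      thus ?thesis by (metis dvd_triv_left)
    qed
    show "N (N f) = smult e (N f)" for f by (simp add: NN \<open>e = 0\<close>)
    show "N ([:0, 1:] * f) + [:0, 1:] * N f + N (N f) + smult c (N f) + P * f = 0" for f
    proof -
      \<comment> \<open>The expansion of the required identity once \<open>N (N f) = 0\<close> and
        the rule for \<open>divdiff c (t * f)\<close> are inserted; \<open>Q\<close>,
        \<open>C\<close>, \<open>D\<close> stand for \<open>P\<close>, the constant \<open>c\<close>
        and \<open>divdiff c f\<close>.\<close>
      have ring: "- (Q * (f + (- C - t) * D)) + t * - (Q * D) + C * - (Q * D) + Q * f = 0"
        for C D Q :: "'a poly" by (simp add: algebra_simps)
      have "smult c (N f) = [:c:] * N f" by simp
      thus ?thesis using ring[of P "[:c:]" "divdiff c f"]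
        unfolding NN unfolding N_def divdiff_X_mult t_def by (simp only: add_0_right)
    qed
  qed
  thus ?thesis unfolding P_def by (rule pq_difference_of_operator)
next
  assume e: "(2 :: 'a) = 0 \<and> e = c"
  define N where "N f = P * pderiv f" for f
  have double: "f + f = 0" for f :: "'a poly"
  proof -
    have "f + f = smult 2 f" by (metis one_add_one smult_1_left smult_add_left)
    thus ?thesis using e by simp
  qed
  \<comment> \<open>The linear coefficient survives and \<open>2 * t\<close> vanishes, so
    \<open>N (N f) = c * N f\<close>. This is where \<open>e = c\<close> enters.\<close>
  have P': "pderiv P = [:c:]" using e by (simp add: P_def pderiv_pCons)
  obtain n where "Vector_Spaces.linear scale scale n" "\<forall>v. n (n v) = e *s n v"
    "\<forall>v. n (u v) + u (n v) + n (n v) + c *s n v + act P v = 0"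
  proof (rule lift_poly_operator[OF irr ann, of N e c])
    show "N (f + g) = N f + N g" for f g by (simp add: N_def pderiv_add algebra_simps)
    show "N (smult a f) = smult a (N f)" for a f by (simp add: N_def pderiv_smult)
    show "P ^ m dvd N f" if "P ^ m dvd f" for m f
      unfolding N_def using that by (rule power_dvd_mult_pderiv)
    show NN: "N (N f) = smult e (N f)" for f
    proof -
      have "N (N f) = P * (pderiv f * [:c:])"
        unfolding N_def pderiv_mult P' using pderiv_pderiv_char_2[of f] e by simp
      thus ?thesis using e by (simp add: N_def)
    qed
    show "N ([:0, 1:] * f) + [:0, 1:] * N f + N (N f) + smult c (N f) + P * f = 0" for f
    proof -
      define t :: "'a poly" where "t = [:0, 1:]"
      have "pderiv t = 1" by (simp add: t_def pderiv_pCons)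
      hence "N (t * f) = t * N f + P * f" unfolding N_def pderiv_mult by (simp add: algebra_simps)
      moreover have "N (N f) = smult c (N f)" using NN e by simp
      \<comment> \<open>Each term occurs twice, so the sum is zero in characteristic 2.\<close>
      ultimately have "N (t * f) + t * N f + N (N f) + smult c (N f) + P * f
        = (t * N f + t * N f) + (smult c (N f) + smult c (N f)) + (P * f + P * f)"
        by (simp only: add_ac)
      thus ?thesis unfolding double t_def by simp
    qed
  qed
  thus ?thesis unfolding P_def by (rule pq_difference_of_operator)
qed

end

section \<open>Roots and coefficients of the two quadratics\<close>

text \<open>With \<open>P\<close> the quadratic with coefficients \<open>d\<close>,
  \<open>c\<close>, 1, the roots of the first polynomial are those of \<open>P\<close> shifted by
  \<open>y\<close>, and those of the second are \<open>y\<close> and \<open>y + e\<close>. The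
  differences are therefore the roots of \<open>P\<close> and their shifts by \<open>- e\<close>; a
  shift by \<open>e\<close> preserves the roots of \<open>P\<close> in both cases.\<close>

lemma Root_difference:
  fixes c d e y :: "'a::field"
  assumes e: "e = 0 \<or> (2 :: 'a) = 0 \<and> e = c"
  shows "z \<in> {x - y' | x y'. x \<in> Root [:d - c * y + y\<^sup>2, c - (y + y), 1:] \<and>
      y' \<in> Root [:y\<^sup>2 + e * y, - (y + y) - e, 1:]} \<longleftrightarrow> poly (map_poly to_ac [:d, c, 1:]) z = 0"
proof -
  define D C E Y where "D = to_ac d" "C = to_ac c" "E = to_ac e" "Y = to_ac y"
  have p: "x \<in> Root [:d - c * y + y\<^sup>2, c - (y + y), 1:] \<longleftrightarrow> (x - Y)\<^sup>2 + C * (x - Y) + D = 0" for x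
    by (simp add: Root_def map_poly_pCons D_C_E_Y_def power2_eq_square algebra_simps)
  have q: "y' \<in> Root [:y\<^sup>2 + e * y, - (y + y) - e, 1:] \<longleftrightarrow> y' = Y \<or> y' = Y + E" for y'
  proof -
    have "y' \<in> Root [:y\<^sup>2 + e * y, - (y + y) - e, 1:] \<longleftrightarrow> (y' - Y) * (y' - (Y + E)) = 0"
      by (simp add: Root_def map_poly_pCons D_C_E_Y_def power2_eq_square algebra_simps)
    thus ?thesis by auto
  qed
  have P: "poly (map_poly to_ac [:d, c, 1:]) w = 0 \<longleftrightarrow> w\<^sup>2 + C * w + D = 0" for w
    by (simp add: map_poly_pCons D_C_E_Y_def power2_eq_square algebra_simps)
  have shift: "(w + E)\<^sup>2 + C * (w + E) + D = w\<^sup>2 + C * w + D" for w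
    using e
  proof
    assume "(2 :: 'a) = 0 \<and> e = c"
    hence "to_ac (2 :: 'a) = 0" "E = C" by (simp_all add: D_C_E_Y_def)
    hence two: "(2 :: 'a alg_closure) = 0" by simp
    have "(w + E)\<^sup>2 + C * (w + E) + D = w\<^sup>2 + C * w + D + 2 * (w * C + C * C)"
      unfolding \<open>E = C\<close> by (simp add: power2_eq_square algebra_simps)
    thus ?thesis unfolding two by simp
  qed (simp add: D_C_E_Y_def)
  show ?thesis
  proof
    assume "z \<in> {x - y' | x y'. x \<in> Root [:d - c * y + y\<^sup>2, c - (y + y), 1:] \<and>
      y' \<in> Root [:y\<^sup>2 + e * y, - (y + y) - e, 1:]}"
    then obtain x y' where xy: "z = x - y'" "(x - Y)\<^sup>2 + C * (x - Y) + D = 0" "y' = Y \<or> y' = Y + E"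
      unfolding mem_Collect_eq p q by blast
    hence "z = x - Y \<or> z + E = x - Y" by auto
    thus "poly (map_poly to_ac [:d, c, 1:]) z = 0" unfolding P using xy(2) shift[of z] by auto
  next
    assume "poly (map_poly to_ac [:d, c, 1:]) z = 0"
    thus "z \<in> {x - y' | x y'. x \<in> Root [:d - c * y + y\<^sup>2, c - (y + y), 1:] \<and>
      y' \<in> Root [:y\<^sup>2 + e * y, - (y + y) - e, 1:]}"
      unfolding P mem_Collect_eq p q by (intro exI[of _ "z + Y"] exI[of _ Y]) simp
  qed
qed

lemma monic_quadratic:
  assumes "lead_coeff p = 1" "degree p = 2"
  shows "p = [:coeff p 0, coeff p 1, 1:]"
proof (rule poly_eqI)
  fix n :: nat
  consider "n = 0" | "n = 1" | "n = 2" | "2 < n" by linarith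
  thus "coeff p n = coeff [:coeff p 0, coeff p 1, 1:] n"
    using assms by cases (auto simp: coeff_eq_0 coeff_pCons numeral_2_eq_2 split: nat.split)
qed

text \<open>The roots add up to \<open>- q1\<close>, so the second one exceeds \<open>y\<close> by
  \<open>- q1 - (y + y)\<close>; the right-hand side is the product of the two linear
  factors.\<close>

lemma quadratic_with_root:
  fixes q :: "'a::field poly"
  assumes q: "q = [:q0, q1, 1:]" and root: "poly q y = 0"
  shows "q = [:y\<^sup>2 + (- q1 - (y + y)) * y, - (y + y) - (- q1 - (y + y)), 1:]"
proof -
  have "q0 = - q1 * y - y * y" using root unfolding q by (simp add: algebra_simps eq_neg_iff_add_eq_0)
  thus ?thesis unfolding q by (simp add: power2_eq_square algebra_simps)
qed

text \<open>Comparing degrees and leading coefficients gives \<open>q = (t - x)^2\<close>, so the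
  given root \<open>y\<close> coincides with the double root \<open>x\<close>.\<close>

lemma double_root_quadratic:
  fixes q :: "'a::field poly"
  assumes q: "q = [:q0, q1, 1:]" and root: "poly q y = 0" and order: "Polynomial.order x q = 2"
  shows "q1 = - (y + y)"
proof -
  have "q \<noteq> 0" by (simp add: q)
  have "[:- x, 1:] ^ 2 dvd q" using order_1[of x q] order by simp
  then obtain h where h: "q = [:- x, 1:] ^ 2 * h" by (rule dvdE)
  have "h \<noteq> 0" using h \<open>q \<noteq> 0\<close> by auto
  have "degree q = degree ([:- x, 1:] ^ 2) + degree h"
    unfolding h using \<open>h \<noteq> 0\<close> by (intro degree_mult_eq) auto
  hence "degree h = 0" by (simp add: q degree_power_eq)
  then obtain a where "h = [:a:]" by (rule degree_eq_zeroE)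
  hence eq: "[:q0, q1, 1:] = [:a * (x * x), - (a * x) - a * x, a:]"
    using h unfolding q by (simp add: power2_eq_square algebra_simps)
  hence "a = 1" "q1 = - (x + x)" "q0 = x * x" by simp_all
  moreover from this have "(y - x) * (y - x) = 0" using root unfolding q by (simp add: algebra_simps)
  ultimately show ?thesis by simp
qed

theorem theorem3p14:
  fixes p q :: "'a::field poly" and y :: 'a
    and scale :: "'a \<Rightarrow> 'v::ab_group_add \<Rightarrow> 'v" and Basis :: "'v set"
    and u :: "'v \<Rightarrow> 'v"
  assumes "lead_coeff p = 1" and "degree p = 2"
    and "lead_coeff q = 1" and "degree q = 2"
    and "irreducible p" and "splits q"
    and "(\<exists>x. Polynomial.order x q = 2) \<or> (CHAR('a) = 2 \<and> poly_tr q = poly_tr p)"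
    and "poly q y = 0"
    and "finite_dimensional_vector_space scale Basis"
    and "Vector_Spaces.linear scale scale u"
  shows "(pq_difference scale p q u \<and> d_exceptional scale p q u
            \<longleftrightarrow> (\<exists>k. is_minimal_poly scale u (pcompose p [:y, 1:] ^ k)))
       \<and> ((\<exists>k. is_minimal_poly scale u (pcompose p [:y, 1:] ^ k))
            \<longleftrightarrow> (\<exists>bs ns. ordered_basis scale bs \<and> (\<forall>n\<in>set ns. 0 < n) \<and>
                   represented_by scale bs u
                     (diag_block_mat (map (\<lambda>n. companion_mat (pcompose p [:y, 1:] ^ n)) ns))))"
proof -
  interpret endo_space scale Basis u
    using assms(9,10) by (simp add: endo_space_def endo_space_axioms_def)
  define p0 p1 q1 where coeffs: "p0 = coeff p 0" "p1 = coeff p 1" "q1 = coeff q 1"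
  have p: "p = [:p0, p1, 1:]" unfolding coeffs using assms(1,2) by (rule monic_quadratic)
  have q: "q = [:coeff q 0, q1, 1:]" unfolding coeffs using assms(3,4) by (rule monic_quadratic)
  \<comment> \<open>Here \<open>d\<close> and \<open>c\<close> are the lower coefficients of
    \<open>P = p(t + y)\<close>, and \<open>e\<close> is the other root of \<open>q\<close> minus
    \<open>y\<close>.\<close>
  define c d e where cde: "c = p1 + (y + y)" "d = p0 + y * p1 + y * y" "e = - q1 - (y + y)"
  define P where "P = pcompose p [:y, 1:]"
  have P: "P = [:d, c, 1:]"
    unfolding P_def p cde by (simp add: pcompose_pCons algebra_simps)
  have irr: "irreducible P" unfolding P_def using assms(5) by (rule irreducible_pcompose_shift)
  have monic: "lead_coeff P = 1" by (simp add: P)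
  \<comment> \<open>A double root means \<open>e = 0\<close>. For equal traces, \<open>c - e\<close>
    is a multiple of 2.\<close>
  have e: "e = 0 \<or> (2 :: 'a) = 0 \<and> e = c"
    using assms(7)
  proof
    assume "\<exists>x. Polynomial.order x q = 2"
    then obtain x where "Polynomial.order x q = 2" ..
    hence "q1 = - (y + y)" by (rule double_root_quadratic[OF q assms(8)])
    thus ?thesis by (simp add: cde)
  next
    assume *: "CHAR('a) = 2 \<and> poly_tr q = poly_tr p"
    have two: "(2 :: 'a) = 0" using of_nat_CHAR[where 'a = 'a] * by simp
    have "q1 = p1" using * assms(2,4) by (simp add: poly_tr_def coeffs)
    hence "c - e = 2 * (p1 + (y + y))" by (simp add: cde algebra_simps)
    thus ?thesis unfolding two by simp
  qed
  have p_eq: "p = [:d - c * y + y\<^sup>2, c - (y + y), 1:]"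
    unfolding p cde by (simp add: power2_eq_square algebra_simps)
  have q_eq: "q = [:y\<^sup>2 + e * y, - (y + y) - e, 1:]"
    unfolding cde by (rule quadratic_with_root[OF q assms(8)])
  have exceptional: "d_exceptional scale p q u \<longleftrightarrow> (\<exists>k. annihilates scale (P ^ k) u)"
    unfolding annihilates_power_iff_eigenvalues[OF irr]
    unfolding d_exceptional_def p_eq q_eq Root_difference[OF e] P by (rule refl)
  \<comment> \<open>Hence exceptionality alone makes \<open>u\<close> a difference, and all three
    conditions reduce to annihilation by a power of \<open>P\<close>.\<close>
  have difference: "pq_difference scale p q u" if "annihilates scale (P ^ k) u" for k
    unfolding p_eq q_eq using irr that e unfolding P by (rule pq_difference_of_annihilated)
  show ?thesis
    unfolding P_def[symmetric] is_minimal_poly_power_iff[OF irr monic] exceptional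
    using difference annihilates_power_iff_companion_form[OF irr monic] by blast
qed

end
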